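(* Let $\Omega=(a,b)$ be a bounded interval and $\lambda>0$. Assume that $g$ is linear with $g'>0$ (i.e. $g(x)=kx+\ell$ with constants $k>0$, $\ell\in\mathbb{R}$) and that $K(\rho)=\rho/(1+\rho)$ for $\rho\ge0$. Let $U$ be a non-decreasing piecewise constant minimizer of $TV_{Kg}$ over $BV(a,b)$ which jumps exactly at $a<a_1<a_2<\cdots<a_m<b$. Then $a_{i+1}-a_i$ ($i=1,\ldots,m-1$) and the jump size $U(a_i+0)-U(a_i-0)$ ($i=1,\ldots,m$) are independent of $i$.
   Context: For $u\in BV(\Omega)$, $\Omega=(a,b)$, with distributional derivative $Du$, jump set $J_u$ and one-sided limits $u^\pm$ at points of $J_u$, set $$TV_K(u)=\int_{\Omega\setminus J_u}|Du|+\sum_{x\in J_u}K(|u^+(x)-u^-(x)|),\qquad TV_{Kg}(u)=TV_K(u)+\frac{\lambda}{2}\int_\Omega|u-g|^2\,dx.$$ Here $U(x\pm0)=\lim_{\delta\downarrow0}U(x\pm\delta)$. *)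

theory Defs
  imports "HOL-Analysis.Analysis"
begin

text \<open>Elements of \<open>L\<^sup>1(\<Omega>)\<close> and \<open>BV(\<Omega>)\<close> are represented by functions; values outside \<open>\<Omega>\<close> are
  irrelevant, and every notion below up to and including the energies depends only on the
  a.e. equivalence class on \<open>\<Omega>\<close>, which is meant to be open.\<close>

definition test_function :: "real set \<Rightarrow> (real \<Rightarrow> real) \<Rightarrow> bool" where
  "test_function \<Omega> \<phi> \<longleftrightarrow>
     (\<forall>n x. (deriv ^^ n) \<phi> differentiable (at x)) \<and>
     compact (closure {x. \<phi> x \<noteq> 0}) \<and> closure {x. \<phi> x \<noteq> 0} \<subseteq> \<Omega>"

text \<open>The distributional derivative \<open>Du\<close> is the finite signed Borel measure \<open>P - N\<close> on \<open>\<Omega>\<close>.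
  A signed measure is represented by its Jordan decomposition, i.e. by the unique pair of
  mutually singular finite measures whose difference it is.\<close>

definition has_distr_deriv ::
    "real set \<Rightarrow> (real \<Rightarrow> real) \<Rightarrow> real measure \<times> real measure \<Rightarrow> bool" where
  "has_distr_deriv \<Omega> u = (\<lambda>(P, N).
     finite_measure P \<and> finite_measure N \<and>
     sets P = sets (restrict_space borel \<Omega>) \<and> sets N = sets (restrict_space borel \<Omega>) \<and>
     (\<exists>A\<in>sets P. emeasure P A = 0 \<and> emeasure N (\<Omega> - A) = 0) \<and>
     (\<forall>\<phi>. test_function \<Omega> \<phi> \<longrightarrow>
        (LINT x:\<Omega>|lebesgue. u x * deriv \<phi> x) = - ((LINT x|P. \<phi> x) - (LINT x|N. \<phi> x))))"

definition BV :: "real set \<Rightarrow> (real \<Rightarrow> real) set" where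
  "BV \<Omega> = {u. set_integrable lebesgue \<Omega> u \<and> (\<exists>D. has_distr_deriv \<Omega> u D)}"

text \<open>The total variation measure \<open>|Du| = P + N\<close>; only meaningful for \<open>u \<in> BV \<Omega>\<close>, for which the
  chosen pair is unique.\<close>

definition total_variation :: "real set \<Rightarrow> (real \<Rightarrow> real) \<Rightarrow> real set \<Rightarrow> ennreal" where
  "total_variation \<Omega> u B =
     (case (SOME D. has_distr_deriv \<Omega> u D) of (P, N) \<Rightarrow> emeasure P B + emeasure N B)"

text \<open>The one-sided limits \<open>u\<^sup>\<plusminus>\<close> are essential limits (null sets are ignored), so that they do
  not depend on the representative; for \<open>u \<in> BV \<Omega>\<close> they exist at every point of \<open>\<Omega>\<close> and are the
  ordinary one-sided limits of any good representative.\<close>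

abbreviation ess_at_right :: "real \<Rightarrow> real filter" where
  "ess_at_right x \<equiv> inf (at_right x) (ae_filter lebesgue)"

abbreviation ess_at_left :: "real \<Rightarrow> real filter" where
  "ess_at_left x \<equiv> inf (at_left x) (ae_filter lebesgue)"

definition jump_set :: "real set \<Rightarrow> (real \<Rightarrow> real) \<Rightarrow> real set" where
  "jump_set \<Omega> u = {x\<in>\<Omega>. \<exists>l r. (u \<longlongrightarrow> l) (ess_at_left x) \<and> (u \<longlongrightarrow> r) (ess_at_right x) \<and> l \<noteq> r}"

text \<open>The energies take values in \<open>[0,\<infinity>]\<close>; \<open>K\<close> is meant to be nonnegative on \<open>[0,\<infinity>)\<close>.\<close>

definition TV_K :: "(real \<Rightarrow> real) \<Rightarrow> real set \<Rightarrow> (real \<Rightarrow> real) \<Rightarrow> ennreal" where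
  "TV_K K \<Omega> u = total_variation \<Omega> u (\<Omega> - jump_set \<Omega> u)
     + (\<Sum>\<^sub>\<infinity>x\<in>jump_set \<Omega> u. ennreal (K \<bar>Lim (ess_at_right x) u - Lim (ess_at_left x) u\<bar>))"

definition TV_Kg ::
    "(real \<Rightarrow> real) \<Rightarrow> real \<Rightarrow> (real \<Rightarrow> real) \<Rightarrow> real set \<Rightarrow> (real \<Rightarrow> real) \<Rightarrow> ennreal" where
  "TV_Kg K lam g \<Omega> u =
     TV_K K \<Omega> u + ennreal (lam / 2) * (\<integral>\<^sup>+x\<in>\<Omega>. ennreal (\<bar>u x - g x\<bar>\<^sup>2) \<partial>lebesgue)"

definition TV_Kg_minimizer ::
    "(real \<Rightarrow> real) \<Rightarrow> real \<Rightarrow> (real \<Rightarrow> real) \<Rightarrow> real set \<Rightarrow> (real \<Rightarrow> real) \<Rightarrow> bool" where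
  "TV_Kg_minimizer K lam g \<Omega> U \<longleftrightarrow>
     U \<in> BV \<Omega> \<and> (\<forall>v\<in>BV \<Omega>. TV_Kg K lam g \<Omega> U \<le> TV_Kg K lam g \<Omega> v)"

text \<open>The values at the finitely many exceptional points are not restricted.\<close>

definition piecewise_constant_on :: "real set \<Rightarrow> (real \<Rightarrow> real) \<Rightarrow> bool" where
  "piecewise_constant_on \<Omega> U \<longleftrightarrow>
     (\<exists>S. finite S \<and> (\<forall>C\<in>components (\<Omega> - S). U constant_on C))"

end

theory Submission
  imports Defs
begin

text \<open>Let two neighbouring jumps \<open>p < q\<close> have sizes \<open>x\<close> and \<open>y\<close>. Stationarity of the energy under
  moving \<open>p\<close> (or \<open>q\<close>) alone puts \<open>g p\<close> at the midpoint of the jump. Now raise the plateau between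
  them by \<open>t\<close> and move both jumps by \<open>t / (2 k)\<close>, which keeps them at their midpoints: up to a
  constant the energy becomes \<open>G (x + t) + G (y - t)\<close> with
  \<open>G \<rho> = \<rho> / (1 + \<rho>) + \<lambda> \<rho>\<^sup>3 / (24 k)\<close>. The first-order condition alone admits \<open>x \<noteq> y\<close>, but then, with
  \<open>A = 1 / (1 + x)\<close> and \<open>B = 1 / (1 + y)\<close>, the second-order condition reads \<open>(A + B) (A - B)\<^sup>2 \<le> 0\<close>. Hence
  \<open>x = y\<close>, and the midpoint conditions give \<open>q - p = x / k\<close>.\<close>

section \<open>Smooth approximations of rays\<close>

text \<open>The family of all \<open>flat e r\<close> is closed under differentiation, and so are the sums of products
  in \<open>bumps\<close> below; for \<open>r = 1\<close> and \<open>e \<rightarrow> 0\<close> it approximates the indicator of the positive half-line.\<close>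

definition flat :: "real \<Rightarrow> real poly \<Rightarrow> real \<Rightarrow> real" where
  "flat e r x = (if x > 0 then poly r (1 / x) * exp (- e / x) else 0)"

text \<open>The free exponent \<open>n\<close> makes the induction on \<open>r\<close> close:
  \<open>pCons a r\<close> splits into the monomial part \<open>a * y ^ n\<close>, beaten by the
  exponential, and a part with the shorter polynomial \<open>r\<close> and exponent
  \<open>Suc n\<close>.\<close>

lemma poly_exp_tendsto_0:
  fixes e :: real
  assumes "e > 0"
  shows "((\<lambda>y. y ^ n * poly r y * exp (- e * y)) \<longlongrightarrow> 0) at_top"
proof (induction r arbitrary: n)
  case 0
  then show ?case by simp
next
  case (pCons a r)
  have 1: "((\<lambda>y. a * (y ^ n * exp (- e * y))) \<longlongrightarrow> a * 0) at_top"
  proof (intro tendsto_mult tendsto_const)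
    have "LIM y at_top. e * y :> at_top"
      using assms by (intro filterlim_tendsto_pos_mult_at_top[OF tendsto_const]) (auto simp: filterlim_ident)
    from filterlim_compose[OF tendsto_power_div_exp_0 this, of n]
    have "((\<lambda>y. inverse (e ^ n) * ((e * y) ^ n / exp (e * y))) \<longlongrightarrow> inverse (e ^ n) * 0) at_top"
      by (intro tendsto_mult tendsto_const)
    then show "((\<lambda>y. y ^ n * exp (- e * y)) \<longlongrightarrow> 0) at_top"
      using assms by (simp add: power_mult_distrib exp_minus field_simps)
  qed
  have "((\<lambda>y. a * (y ^ n * exp (- e * y)) + y ^ Suc n * poly r y * exp (- e * y)) \<longlongrightarrow> a * 0 + 0) at_top"
    by (rule tendsto_add[OF 1 pCons.IH])
  then show ?case by (simp add: algebra_simps)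
qed

lemma flat_tendsto_0:
  assumes "e > 0"
  shows "(flat e r \<longlongrightarrow> 0) (at 0)"
proof (rule filterlim_split_at)
  have "\<forall>\<^sub>F x in at_left (0::real). flat e r x = 0"
    by (simp add: eventually_at_filter flat_def)
  then show "(flat e r \<longlongrightarrow> 0) (at_left 0)" by (rule tendsto_eventually)
  have "((\<lambda>x. poly r (inverse x) * exp (- e * inverse x)) \<longlongrightarrow> 0) (at_right 0)"
    using filterlim_compose[OF poly_exp_tendsto_0[OF assms, of 0 r] filterlim_inverse_at_top_right] by simp
  then show "(flat e r \<longlongrightarrow> 0) (at_right 0)"
    by (rule Lim_transform_eventually)
       (auto simp: eventually_at_filter flat_def field_simps)
qed

text \<open>With \<open>y = 1 / x\<close> one has d/dx = - y^2 d/dy, which turns the factor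
  \<open>r\<close> into y^2 (e r - r'). Only the origin needs a limit argument.\<close>

lemma flat_DERIV:
  assumes "e > 0"
  shows "DERIV (flat e r) x :> flat e (monom 1 2 * (smult e r - pderiv r)) x"
proof -
  consider "x > 0" | "x = 0" | "x < 0" by linarith
  then show ?thesis
  proof cases
    case 1
    have "((\<lambda>x. poly r (1 / x) * exp (- e / x)) has_field_derivative
       flat e (monom 1 2 * (smult e r - pderiv r)) x) (at x)"
    proof -
      have "((\<lambda>x. poly r (1 / x) * exp (- e / x)) has_field_derivative
        poly (pderiv r) (1 / x) * (- 1 / (x * x)) * exp (- e / x) + exp (- e / x) * (e / (x * x)) * poly r (1 / x)) (at x)"
        using 1 by (auto intro!: derivative_eq_intros)
      then show ?thesis
        using 1 by (simp add: flat_def poly_monom power2_eq_square algebra_simps)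
    qed
    then show ?thesis
      by (rule has_field_derivative_transform_within_open[of _ _ _ "{0<..}"]) (use 1 in \<open>auto simp: flat_def\<close>)
  next
    case 3
    have "((\<lambda>x. 0) has_field_derivative flat e (monom 1 2 * (smult e r - pderiv r)) x) (at x)"
      using 3 by (auto simp: flat_def)
    then show ?thesis
      by (rule has_field_derivative_transform_within_open[of _ _ _ "{..<0}"]) (use 3 in \<open>auto simp: flat_def\<close>)
  next
    case 2
    \<comment> \<open>The difference quotient at 0 is again a flat function: dividing by
      \<open>h\<close> multiplies the polynomial in \<open>1 / h\<close> by its variable, giving
      \<open>pCons 0 r\<close>.\<close>
    have "((\<lambda>h. flat e r h / h) \<longlongrightarrow> 0) (at 0)"
      by (rule Lim_transform_eventually[OF flat_tendsto_0[OF assms, of "pCons 0 r"]])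
         (auto simp: eventually_at_filter flat_def)
    then show ?thesis using 2 by (simp add: DERIV_def flat_def)
  qed
qed

inductive_set bumps :: "real \<Rightarrow> real \<Rightarrow> real \<Rightarrow> (real \<Rightarrow> real) set" for e s t where
  base: "(\<lambda>x. flat e r (x - s) * flat e r' (t - x)) \<in> bumps e s t"
| add: "f \<in> bumps e s t \<Longrightarrow> f' \<in> bumps e s t \<Longrightarrow> (\<lambda>x. f x + f' x) \<in> bumps e s t"

lemma flat_minus: "flat e (- r) x = - flat e r x"
  by (simp add: flat_def)

text \<open>By the product rule a base product yields a sum of two base products. The sign produced
  by the reflected argument \<open>t - x\<close> is absorbed into the polynomial through
  \<open>flat_minus\<close>.\<close>

lemma bumps_DERIV:
  assumes "f \<in> bumps e s t" "e > 0"
  shows "\<exists>f'\<in>bumps e s t. \<forall>x. DERIV f x :> f' x"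
  using assms(1)
proof induction
  case (base r r')
  define D where "D r = monom 1 2 * (smult e r - pderiv r)" for r
  have "DERIV (\<lambda>x. flat e r (x - s) * flat e r' (t - x)) x :>
     flat e (D r) (x - s) * flat e r' (t - x) + flat e r (x - s) * flat e (- D r') (t - x)" for x
  proof -
    have 1: "DERIV (\<lambda>x. flat e r (x - s)) x :> flat e (D r) (x - s)"
      unfolding D_def using DERIV_chain2[where g = "\<lambda>x. x - s" and Db = 1 and x = x and s = UNIV, OF flat_DERIV[OF assms(2), of r]]
      by (simp add: DERIV_diff[OF DERIV_ident DERIV_const, simplified])
    have 2: "DERIV (\<lambda>x. flat e r' (t - x)) x :> flat e (- D r') (t - x)"
      unfolding D_def flat_minus
      using DERIV_chain2[where g = "\<lambda>x. t - x" and Db = "- 1" and x = x and s = UNIV, OF flat_DERIV[OF assms(2), of r']]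
      by (simp add: DERIV_diff[OF DERIV_const DERIV_ident, simplified])
    show ?thesis using DERIV_mult[OF 1 2] by (simp add: algebra_simps)
  qed
  then show ?case
    using bumps.add[OF bumps.base bumps.base, of e "D r" s r' t r "- D r'"] by (intro bexI allI)
next
  case (add f f')
  then obtain h h' where "h \<in> bumps e s t" "\<forall>x. DERIV f x :> h x"
    "h' \<in> bumps e s t" "\<forall>x. DERIV f' x :> h' x" by blast
  then show ?case by (intro bexI[of _ "\<lambda>x. h x + h' x"] allI DERIV_add bumps.add) auto
qed

lemma bumps_smooth:
  assumes "f \<in> bumps e s t" "e > 0"
  shows "(deriv ^^ n) f \<in> bumps e s t"
proof (induction n)
  case (Suc n)
  then obtain f' where f': "f' \<in> bumps e s t" "\<forall>x. DERIV ((deriv ^^ n) f) x :> f' x"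
    using bumps_DERIV assms(2) by blast
  then have "deriv ((deriv ^^ n) f) = f'" by (auto intro!: ext DERIV_imp_deriv)
  then show ?case using f' by simp
qed (use assms in simp)

lemma test_function_bump:
  assumes "e > 0" "a < s" "t < b"
  shows "test_function {a<..<b} (\<lambda>x. flat e 1 (x - s) * flat e 1 (t - x))" (is "test_function _ ?f")
  unfolding test_function_def
proof (intro conjI allI)
  fix n x
  show "(deriv ^^ n) ?f differentiable at x"
    using bumps_DERIV[OF bumps_smooth[OF bumps.base[of e 1 s 1 t] assms(1), of n] assms(1)]
    by (auto simp: real_differentiable_def)
next
  \<comment> \<open>The two factors vanish for \<open>x \<le> s\<close> and for
    \<open>x \<ge> t\<close>. If \<open>t \<le> s\<close> the bump is identically 0, a case that can
    occur for small indices in the approximation of rays.\<close>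
  have "{x. ?f x \<noteq> 0} \<subseteq> {s..t}" by (auto simp: flat_def)
  then have sub: "closure {x. ?f x \<noteq> 0} \<subseteq> {s..t}" by (rule closure_minimal) simp
  then show "compact (closure {x. ?f x \<noteq> 0})"
    by (meson bounded_subset bounded_closed_interval closed_closure compact_eq_bounded_closed)
  show "closure {x. ?f x \<noteq> 0} \<subseteq> {a<..<b}" using sub assms by auto
qed

lemma flat_tendsto_1:
  assumes "x > 0" "(e \<longlongrightarrow> 0) F" "(y \<longlongrightarrow> x) F"
  shows "((\<lambda>n. flat (e n) 1 (y n)) \<longlongrightarrow> 1) F"
proof -
  have "((\<lambda>n. exp (- e n / y n)) \<longlongrightarrow> exp (- 0 / x)) F"
    using assms by (intro tendsto_intros) auto
  moreover have "\<forall>\<^sub>F n in F. exp (- e n / y n) = flat (e n) 1 (y n)"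
    using order_tendstoD(1)[OF assms(3,1)] by eventually_elim (simp add: flat_def)
  ultimately show ?thesis using Lim_transform_eventually by fastforce
qed

lemma flat_bounds: "e \<ge> 0 \<Longrightarrow> 0 \<le> flat e 1 x \<and> flat e 1 x \<le> 1"
  by (simp add: flat_def)

lemma test_functions_approximate_ray:
  assumes "a < b"
  obtains \<phi> where "\<And>n::nat. test_function {a<..<b} (\<phi> n)" "\<And>n x. 0 \<le> \<phi> n x \<and> \<phi> n x \<le> 1"
    "\<And>x. (\<lambda>n. \<phi> n x) \<longlonglongrightarrow> indicator ({a<..<b} \<inter> {z<..}) x"
proof
  \<comment> \<open>The limit set is the interval from \<open>max a z\<close> to \<open>b\<close>.
    The supports exhaust it from inside while the parameter of \<open>flat\<close> tends to 0, so
    every bump vanishes off this interval.\<close>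
  define s where "s = max a z"
  define S T where "S n = s + inverse (real (Suc n))" and "T n = b - inverse (real (Suc n))" for n
  define \<phi> where "\<phi> n = (\<lambda>x. flat (inverse (real (Suc n))) 1 (x - S n) * flat (inverse (real (Suc n))) 1 (T n - x))" for n
  show "test_function {a<..<b} (\<phi> n)" for n
    unfolding \<phi>_def
  proof (rule test_function_bump)
    have "0 < inverse (real (Suc n))" by simp
    moreover have "a \<le> s" by (simp add: s_def)
    ultimately show "0 < inverse (real (Suc n))" "a < S n" "T n < b"
      unfolding S_def T_def by linarith+
  qed
  show "0 \<le> \<phi> n x \<and> \<phi> n x \<le> 1" for n x
    unfolding \<phi>_def using flat_bounds[of "inverse (real (Suc n))"] by (auto intro!: mult_nonneg_nonneg mult_le_one)
  show "(\<lambda>n. \<phi> n x) \<longlonglongrightarrow> indicator ({a<..<b} \<inter> {z<..}) x" for x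
  proof (cases "s < x \<and> x < b")
    case True
    have "(\<lambda>n. x - S n) \<longlonglongrightarrow> x - (s + 0)" "(\<lambda>n. T n - x) \<longlonglongrightarrow> (b - 0) - x"
      unfolding S_def T_def by (intro tendsto_intros LIMSEQ_inverse_real_of_nat)+
    then have "(\<lambda>n. \<phi> n x) \<longlonglongrightarrow> 1 * 1"
      unfolding \<phi>_def using True by (intro tendsto_mult flat_tendsto_1[OF _ LIMSEQ_inverse_real_of_nat]) auto
    then show ?thesis using True by (simp add: s_def indicator_def)
  next
    case False
    have "\<phi> n x = 0" for n
    proof -
      have "0 < inverse (real (Suc n))" by simp
      then have "x - S n \<le> 0 \<or> T n - x \<le> 0" using False unfolding S_def T_def by linarith
      then show ?thesis by (auto simp: \<phi>_def flat_def)
    qed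
    then show ?thesis using False by (auto simp: s_def indicator_def)
  qed
qed

lemma test_function_continuous:
  assumes "test_function \<Omega> \<phi>"
  shows "continuous_on A \<phi>" "continuous_on A (deriv \<phi>)" "DERIV \<phi> x :> deriv \<phi> x"
proof -
  have 0: "\<phi> differentiable at x" and 1: "deriv \<phi> differentiable at x" for x
    using assms[unfolded test_function_def, THEN conjunct1, rule_format, of 0 x]
      assms[unfolded test_function_def, THEN conjunct1, rule_format, of 1 x] by auto
  show "continuous_on A \<phi>" "continuous_on A (deriv \<phi>)"
    using 0 1 by (auto intro!: continuous_at_imp_continuous_on differentiable_imp_continuous_within)
  show "DERIV \<phi> x :> deriv \<phi> x" using 0 by (simp add: DERIV_deriv_iff_real_differentiable)
qed

lemma test_function_zero: "test_function \<Omega> \<phi> \<Longrightarrow> x \<notin> \<Omega> \<Longrightarrow> \<phi> x = 0"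
  unfolding test_function_def using closure_subset[of "{x. \<phi> x \<noteq> 0}"] by (metis (mono_tags, lifting) mem_Collect_eq subsetD)

section \<open>The distributional derivative of a step function\<close>

text \<open>The identity \<open>P - N = P' - N'\<close> of signed measures, with both sides moved so that no subtraction
  occurs.\<close>

lemma measure_sum_eqI:
  fixes P N P' N' :: "real measure"
  assumes fin: "finite_measure P" "finite_measure N" "finite_measure P'" "finite_measure N'"
    and sets: "sets P = sets (restrict_space borel \<Omega>)" "sets N = sets (restrict_space borel \<Omega>)"
      "sets P' = sets (restrict_space borel \<Omega>)" "sets N' = sets (restrict_space borel \<Omega>)"
    and eq: "\<And>z. measure P (\<Omega> \<inter> {z<..}) + measure N' (\<Omega> \<inter> {z<..}) =
      measure P' (\<Omega> \<inter> {z<..}) + measure N (\<Omega> \<inter> {z<..})"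
    and X: "X \<in> sets (restrict_space borel \<Omega>)"
  shows "emeasure P X + emeasure N' X = emeasure P' X + emeasure N X"
proof -
  interpret P: finite_measure P by fact
  interpret N: finite_measure N by fact
  interpret P': finite_measure P' by fact
  interpret N': finite_measure N' by fact
  \<comment> \<open>The sum of two measures on \<open>\<Omega>\<close> is extended by 0 to a Borel
    measure on the line, where agreement on all open rays together with finiteness there implies
    equality.\<close>
  define S where "S M M' = measure_of UNIV (sets (borel :: real measure))
    (\<lambda>B. emeasure M (\<Omega> \<inter> B) + emeasure M' (\<Omega> \<inter> B))" for M M' :: "real measure"
  have S: "emeasure (S M M') B = emeasure M (\<Omega> \<inter> B) + emeasure M' (\<Omega> \<inter> B)"
    if M: "sets M = sets (restrict_space borel \<Omega>)" "sets M' = sets (restrict_space borel \<Omega>)"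
      and B: "B \<in> sets borel" for M M' B
    unfolding S_def
  proof (rule emeasure_measure_of_sigma)
    show "sigma_algebra UNIV (sets (borel :: real measure))"
      using sets.sigma_algebra_axioms[of "borel :: real measure"] by simp
    have *: "range (\<lambda>i. \<Omega> \<inter> A i) \<subseteq> sets M \<and> range (\<lambda>i. \<Omega> \<inter> A i) \<subseteq> sets M'"
      if "range A \<subseteq> sets borel" for A :: "nat \<Rightarrow> real set"
      using that M by (auto simp: sets_restrict_space)
    have "(\<Sum>i. emeasure M (\<Omega> \<inter> A i) + emeasure M' (\<Omega> \<inter> A i)) =
      emeasure M (\<Omega> \<inter> \<Union> (range A)) + emeasure M' (\<Omega> \<inter> \<Union> (range A))"
      if A: "range A \<subseteq> sets borel" "disjoint_family A" for A :: "nat \<Rightarrow> real set"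
    proof -
      have d: "disjoint_family (\<lambda>i. \<Omega> \<inter> A i)"
        using A(2) unfolding disjoint_family_on_def by auto
      have "(\<Sum>i. emeasure M (\<Omega> \<inter> A i) + emeasure M' (\<Omega> \<inter> A i)) =
        (\<Sum>i. emeasure M (\<Omega> \<inter> A i)) + (\<Sum>i. emeasure M' (\<Omega> \<inter> A i))"
        by (rule suminf_add[symmetric]) (rule summableI)+
      also have "\<dots> = emeasure M (\<Union>i. \<Omega> \<inter> A i) + emeasure M' (\<Union>i. \<Omega> \<inter> A i)"
        using *[OF A(1)] by (simp only: suminf_emeasure[OF _ d])
      finally show ?thesis by (simp only: Int_UN_distrib)
    qed
    then show "countably_additive (sets borel) (\<lambda>B. emeasure M (\<Omega> \<inter> B) + emeasure M' (\<Omega> \<inter> B))"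
      by (auto simp: countably_additive_def)
  qed (use B in \<open>auto simp: positive_def\<close>)
  have sets_S: "sets (S M M') = sets borel" for M M'
    unfolding S_def using sets.sigma_sets_eq[of "borel :: real measure"] by (simp add: sets.space_closed[of borel, simplified])
  have "S P N' = S P' N"
  proof (rule measure_eqI_lessThan)
    fix z :: real
    show "emeasure (S P N') {z<..} < \<infinity>"
      by (simp add: S sets less_top[symmetric])
    show "emeasure (S P N') {z<..} = emeasure (S P' N) {z<..}"
      using eq[of z]
      by (simp add: S sets P.emeasure_eq_measure N.emeasure_eq_measure P'.emeasure_eq_measure
        N'.emeasure_eq_measure flip: ennreal_plus)
  qed (rule sets_S)+
  moreover obtain B where B: "B \<in> sets borel" "X = \<Omega> \<inter> B"
    using X by (auto simp: sets_restrict_space)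
  ultimately show ?thesis
    using S[OF sets(1,4) B(1)] S[OF sets(3,2) B(1)] by simp
qed

section \<open>Uniqueness of the Jordan decomposition of the distributional derivative\<close>

text \<open>Both pairs integrate every test function to the same value. Bumps converging to the
  indicator of a ray carry this over to rays, which determine the measures.\<close>

lemma has_distr_deriv_difference:
  assumes ab: "a < b" and D: "has_distr_deriv {a<..<b} u (P, N)" "has_distr_deriv {a<..<b} u (P', N')"
    and X: "X \<in> sets P"
  shows "emeasure P X + emeasure N' X = emeasure P' X + emeasure N X"
proof -
  let ?\<Omega> = "{a<..<b}"
  note D = D[unfolded has_distr_deriv_def prod.case]
  show ?thesis
  proof (rule measure_sum_eqI[where \<Omega> = ?\<Omega>])
    fix z
    obtain \<phi> where \<phi>: "\<And>n::nat. test_function ?\<Omega> (\<phi> n)" "\<And>n x. 0 \<le> \<phi> n x \<and> \<phi> n x \<le> 1"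
      "\<And>x. (\<lambda>n. \<phi> n x) \<longlonglongrightarrow> indicator (?\<Omega> \<inter> {z<..}) x"
      using test_functions_approximate_ray[OF ab] by blast
    \<comment> \<open>Dominated convergence with the constant bound 1, integrable because
      \<open>M\<close> is finite.\<close>
    have lim: "(\<lambda>n. LINT x|M. \<phi> n x) \<longlonglongrightarrow> measure M (?\<Omega> \<inter> {z<..})"
      if M: "finite_measure M" and sM: "sets M = sets (restrict_space borel ?\<Omega>)" for M
    proof -
      interpret finite_measure M by fact
      have sp: "space M = ?\<Omega>" using sets_eq_imp_space_eq[OF sM] by (simp add: space_restrict_space)
      have "\<phi> n \<in> borel_measurable borel" for n
        using test_function_continuous(1)[OF \<phi>(1)] by (rule borel_measurable_continuous_onI)
      then have m: "\<phi> n \<in> borel_measurable M" for n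
        using measurable_restrict_space1 measurable_cong_sets[OF sM refl] by blast
      have "?\<Omega> \<inter> {z<..} \<in> sets M" unfolding sM by (auto simp: sets_restrict_space)
      then have "(\<lambda>n. LINT x|M. \<phi> n x) \<longlonglongrightarrow> (LINT x|M. indicator (?\<Omega> \<inter> {z<..}) x)"
        using m \<phi> by (intro integral_dominated_convergence[where w = "\<lambda>_. 1"]) (auto simp del: indicator_simps)
      then show ?thesis using sp by (simp add: Int_ac)
    qed
    have *: "(LINT x|P. \<phi> n x) + (LINT x|N'. \<phi> n x) = (LINT x|P'. \<phi> n x) + (LINT x|N. \<phi> n x)" for n
      using D \<phi>(1)[of n] by force
    have 1: "(\<lambda>n. (LINT x|P. \<phi> n x) + (LINT x|N'. \<phi> n x)) \<longlonglongrightarrow>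
      measure P (?\<Omega> \<inter> {z<..}) + measure N' (?\<Omega> \<inter> {z<..})"
      using D by (intro tendsto_add lim) auto
    have 2: "(\<lambda>n. (LINT x|P'. \<phi> n x) + (LINT x|N. \<phi> n x)) \<longlonglongrightarrow>
      measure P' (?\<Omega> \<inter> {z<..}) + measure N (?\<Omega> \<inter> {z<..})"
      using D by (intro tendsto_add lim) auto
    show "measure P (?\<Omega> \<inter> {z<..}) + measure N' (?\<Omega> \<inter> {z<..}) =
      measure P' (?\<Omega> \<inter> {z<..}) + measure N (?\<Omega> \<inter> {z<..})"
      using LIMSEQ_unique 1 2 unfolding * by blast
  qed (use D X in auto)
qed

text \<open>Minimality of the Jordan decomposition. The separating set \<open>A\<close> carries
  \<open>N\<close> and its complement carries \<open>P\<close>; on \<open>X - A\<close> the identity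
  of differences loses \<open>N\<close>, on \<open>X \<inter> A\<close> it loses \<open>P\<close>,
  and each remaining identity bounds one part.\<close>

lemma has_distr_deriv_le:
  assumes ab: "a < b" and D: "has_distr_deriv {a<..<b} u (P, N)" "has_distr_deriv {a<..<b} u (P', N')"
    and X: "X \<in> sets P"
  shows "emeasure P X \<le> emeasure P' X" "emeasure N X \<le> emeasure N' X"
proof -
  note d = has_distr_deriv_difference[OF ab D]
  note D = D[unfolded has_distr_deriv_def prod.case]
  have sets: "sets P' = sets P" "sets N' = sets P" "sets N = sets P" using D by auto
  have sp: "space P = {a<..<b}"
    using D sets_eq_imp_space_eq[of P "restrict_space borel {a<..<b}"] by (simp add: space_restrict_space)
  obtain A where A: "A \<in> sets P" "emeasure P A = 0" "emeasure N ({a<..<b} - A) = 0" using D by blast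
  have PA: "emeasure P Y = 0" if "Y \<subseteq> A" for Y
    using emeasure_mono[OF that A(1)] A(2) by simp
  have NA: "emeasure N Y = 0" if "Y \<subseteq> space P - A" for Y
    using emeasure_mono[of Y "{a<..<b} - A" N] that A sets.compl_sets[OF A(1)] sets sp by simp
  have X': "X - A \<subseteq> space P - A" using sets.sets_into_space[OF X] by auto
  have split: "emeasure M X = emeasure M (X \<inter> A) + emeasure M (X - A)" if "sets M = sets P" for M
    using plus_emeasure[of "X \<inter> A" M "X - A"] X A(1) that by (simp add: Int_Diff_disjoint Int_Diff_Un)
  have "emeasure P X = emeasure P (X - A)" using split[of P] PA[of "X \<inter> A"] by simp
  also have "\<dots> \<le> emeasure P (X - A) + emeasure N' (X - A)" by simp
  also have "\<dots> = emeasure P' (X - A)" using d[of "X - A"] X A(1) NA[OF X'] by simp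
  also have "\<dots> \<le> emeasure P' X" using X sets by (intro emeasure_mono) auto
  finally show "emeasure P X \<le> emeasure P' X" .
  have "emeasure N X = emeasure N (X \<inter> A)" using split[OF sets(3)] NA[OF X'] by simp
  also have "\<dots> \<le> emeasure P' (X \<inter> A) + emeasure N (X \<inter> A)" by simp
  also have "\<dots> = emeasure N' (X \<inter> A)" using d[of "X \<inter> A"] X A(1) PA[of "X \<inter> A"] by simp
  also have "\<dots> \<le> emeasure N' X" using X sets by (intro emeasure_mono) auto
  finally show "emeasure N X \<le> emeasure N' X" .
qed

text \<open>Two Jordan pairs of the same function bound each other, hence agree, so the pair picked
  by \<open>SOME\<close> may be replaced by any known one.\<close>

lemma total_variation_eq:
  assumes ab: "a < b" and D: "has_distr_deriv {a<..<b} u (P, N)"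
    and X: "X \<in> sets (restrict_space borel {a<..<b})"
  shows "total_variation {a<..<b} u X = emeasure P X + emeasure N X"
proof -
  obtain P' N' where D': "(SOME D. has_distr_deriv {a<..<b} u D) = (P', N')" by fastforce
  then have D'': "has_distr_deriv {a<..<b} u (P', N')" using someI[of "has_distr_deriv {a<..<b} u", OF D] by simp
  have X': "X \<in> sets P" "X \<in> sets P'" using X D D'' by (auto simp: has_distr_deriv_def)
  have "emeasure P' X = emeasure P X" "emeasure N' X = emeasure N X"
    using has_distr_deriv_le[OF ab D D'' X'(1)] has_distr_deriv_le[OF ab D'' D X'(2)] by auto
  then show ?thesis by (simp add: total_variation_def D')
qed

section \<open>Step functions and their jump measures\<close>

text \<open>Open rays make this the left-continuous representative. Writing it by jumps rather than
  by plateaus lets single jumps be moved or resized independently.\<close>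

definition step :: "real \<Rightarrow> real set \<Rightarrow> (real \<Rightarrow> real) \<Rightarrow> real \<Rightarrow> real" where
  "step c J d x = c + (\<Sum>q\<in>J. d q * indicator {q<..} x)"

text \<open>The sum of Dirac masses of weight \<open>d q\<close> at the points \<open>q\<close> of
  \<open>J\<close>. The push-forward replaces the discrete sigma-algebra on \<open>J\<close> by the
  Borel sets of \<open>\<Omega>\<close>, as \<open>has_distr_deriv\<close> demands.\<close>

definition jump_measure :: "real set \<Rightarrow> real set \<Rightarrow> (real \<Rightarrow> real) \<Rightarrow> real measure" where
  "jump_measure \<Omega> J d = distr (point_measure J (\<lambda>q. ennreal (d q))) (restrict_space borel \<Omega>) (\<lambda>x. x)"

lemma step_measurable [measurable]: "step c J d \<in> borel_measurable borel"
  unfolding step_def by measurable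

text \<open>The case \<open>q = a\<close> serves the constant part of a step function, whose
  contribution is then \<open>- \<phi> a = 0\<close>.\<close>

lemma integral_deriv_test_function:
  assumes "test_function {a<..<b} \<phi>" "a \<le> q" "q \<le> b"
  shows "set_integrable lebesgue {q<..<b} (deriv \<phi>)" "(LINT x:{q<..<b}|lebesgue. deriv \<phi> x) = - \<phi> q"
proof -
  have "(deriv \<phi> has_integral (\<phi> b - \<phi> q)) {q..b}"
    using assms test_function_continuous(3)[OF assms(1)]
    by (intro fundamental_theorem_of_calculus)
       (auto simp: has_real_derivative_iff_has_vector_derivative intro: has_vector_derivative_at_within)
  then have 1: "(deriv \<phi> has_integral - \<phi> q) {q<..<b}"
    using test_function_zero[OF assms(1), of b] by (simp add: has_integral_Icc_iff_Ioo)
  have "set_integrable lebesgue {q..b} (deriv \<phi>)"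
    using test_function_continuous(2)[OF assms(1), of "{q..b}"]
    by (metis absolutely_integrable_continuous_real)
  then show 2: "set_integrable lebesgue {q<..<b} (deriv \<phi>)"
    by (rule set_integrable_subset) auto
  show "(LINT x:{q<..<b}|lebesgue. deriv \<phi> x) = - \<phi> q"
    using set_lebesgue_integral_eq_integral(2)[OF 2] 1 by (simp add: integral_unique)
qed

text \<open>Each unit jump at \<open>q\<close> differentiates to the Dirac mass at \<open>q\<close>.
  As the weights are nonnegative, the negative part of the Jordan decomposition is zero and the
  empty set separates the two parts.\<close>

lemma step_has_distr_deriv:
  assumes J: "finite J" "J \<subseteq> {a<..<b}" "\<And>q. q \<in> J \<Longrightarrow> 0 \<le> d q" and ab: "a < b"
  shows "has_distr_deriv {a<..<b} (step c J d)
    (jump_measure {a<..<b} J d, null_measure (restrict_space borel {a<..<b}))"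
  unfolding has_distr_deriv_def prod.case
proof (intro conjI allI impI)
  let ?\<Omega> = "{a<..<b}" and ?P = "jump_measure {a<..<b} J d"
  have m: "(\<lambda>x. x) \<in> point_measure J (\<lambda>q. ennreal (d q)) \<rightarrow>\<^sub>M restrict_space borel ?\<Omega>"
    using J(2) by (auto simp: point_measure_def space_restrict_space)
  show s: "sets ?P = sets (restrict_space borel ?\<Omega>)" by (simp add: jump_measure_def)
  show "finite_measure ?P"
    unfolding jump_measure_def using m J(1) by (intro finite_measure.finite_measure_distr finite_measureI)
      (auto simp: space_point_measure emeasure_point_measure_finite)
  show "finite_measure (null_measure (restrict_space borel ?\<Omega>))"
    by (intro finite_measureI) simp
  show "\<exists>A\<in>sets ?P. emeasure ?P A = 0 \<and> emeasure (null_measure (restrict_space borel ?\<Omega>)) (?\<Omega> - A) = 0"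
    by (intro bexI[of _ "{}"]) auto
  fix \<phi> assume \<phi>: "test_function ?\<Omega> \<phi>"
  have "\<phi> \<in> borel_measurable borel"
    using test_function_continuous(1)[OF \<phi>] by (rule borel_measurable_continuous_onI)
  then have "(LINT x|?P. \<phi> x) = (\<Sum>q\<in>J. d q * \<phi> q)"
    unfolding jump_measure_def using J m
    by (subst integral_distr) (auto simp: lebesgue_integral_point_measure_finite intro: measurable_restrict_space1)
  moreover have "(LINT x:?\<Omega>|lebesgue. step c J d x * deriv \<phi> x) = - (\<Sum>q\<in>J. d q * \<phi> q)"
  proof -
    note I = integral_deriv_test_function[OF \<phi>]
    have "(\<Sum>q\<in>J. d q * indicator {q<..} x) * (indicator ?\<Omega> x * deriv \<phi> x) =
      (\<Sum>q\<in>J. d q * (indicator {q<..<b} x * deriv \<phi> x))" for x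
      unfolding sum_distrib_right using J(2) by (intro sum.cong) (auto simp: indicator_def)
    then have "(LINT x:?\<Omega>|lebesgue. step c J d x * deriv \<phi> x) =
       (LINT x|lebesgue. c * (indicator ?\<Omega> x * deriv \<phi> x) + (\<Sum>q\<in>J. d q * (indicator {q<..<b} x * deriv \<phi> x)))"
      unfolding set_lebesgue_integral_def step_def
      by (intro Bochner_Integration.integral_cong refl) (simp add: algebra_simps)
    also have "\<dots> = c * (LINT x:?\<Omega>|lebesgue. deriv \<phi> x) + (\<Sum>q\<in>J. d q * (LINT x:{q<..<b}|lebesgue. deriv \<phi> x))"
    proof -
      have i: "integrable lebesgue (\<lambda>x. indicator {q<..<b} x * deriv \<phi> x)" if "q \<in> insert a J" for q
        using I(1)[of q] ab J(2) that by (auto simp: set_integrable_def subset_iff)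
      then show ?thesis
        unfolding set_lebesgue_integral_def
        by (subst Bochner_Integration.integral_add)
           (auto intro!: Bochner_Integration.integrable_sum simp: Bochner_Integration.integral_sum)
    qed
    also have "(\<Sum>q\<in>J. d q * (LINT x:{q<..<b}|lebesgue. deriv \<phi> x)) = (\<Sum>q\<in>J. d q * - \<phi> q)"
      using I(2) J(2) by (intro sum.cong) (auto simp: subset_iff)
    also have "c * (LINT x:?\<Omega>|lebesgue. deriv \<phi> x) + (\<Sum>q\<in>J. d q * - \<phi> q) = - (\<Sum>q\<in>J. d q * \<phi> q)"
      using I(2)[of a] ab test_function_zero[OF \<phi>, of a] by (simp add: sum_negf)
    finally show ?thesis .
  qed
  ultimately show "(LINT x:?\<Omega>|lebesgue. step c J d x * deriv \<phi> x) =
    - ((LINT x|?P. \<phi> x) - (LINT x|null_measure (restrict_space borel ?\<Omega>). \<phi> x))"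
    by (simp add: integral_null_measure)
qed simp

lemma step_bounded:
  assumes "finite J"
  shows "\<bar>step c J d x\<bar> \<le> \<bar>c\<bar> + (\<Sum>q\<in>J. \<bar>d q\<bar>)"
proof -
  have "\<bar>\<Sum>q\<in>J. d q * indicator {q<..} x\<bar> \<le> (\<Sum>q\<in>J. \<bar>d q\<bar>)"
    by (rule order_trans[OF sum_abs sum_mono]) (auto simp: indicator_def)
  then show ?thesis unfolding step_def by linarith
qed

lemma step_BV:
  assumes J: "finite J" "J \<subseteq> {a<..<b}" "\<And>q. q \<in> J \<Longrightarrow> 0 \<le> d q" and ab: "a < b"
  shows "step c J d \<in> BV {a<..<b}"
proof -
  have "set_integrable lebesgue {a<..<b} (step c J d)"
    unfolding set_integrable_def
  proof (rule integrableI_bounded_set[where A = "{a<..<b}" and B = "\<bar>c\<bar> + (\<Sum>q\<in>J. \<bar>d q\<bar>)"])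
    show "(\<lambda>x. indicator {a<..<b} x *\<^sub>R step c J d x) \<in> borel_measurable lebesgue"
      by (intro borel_measurable_scaleR measurable_completion) measurable
    show "AE x in lebesgue. x \<in> {a<..<b} \<longrightarrow> norm (indicator {a<..<b} x *\<^sub>R step c J d x) \<le> \<bar>c\<bar> + (\<Sum>q\<in>J. \<bar>d q\<bar>)"
      using step_bounded[OF J(1)] by auto
  qed (use ab in auto)
  then show ?thesis using step_has_distr_deriv[where d = d, OF assms] by (auto simp: BV_def)
qed

lemma total_variation_step_off_jumps:
  assumes J: "finite J" "J \<subseteq> {a<..<b}" "\<And>q. q \<in> J \<Longrightarrow> 0 \<le> d q" and ab: "a < b"
  shows "total_variation {a<..<b} (step c J d) ({a<..<b} - J) = 0"
proof -
  have X: "{a<..<b} - J \<in> sets (restrict_space borel {a<..<b})"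
    using J(1) borel_closed[OF finite_imp_closed[OF J(1)]]
    by (auto simp: sets_restrict_space intro!: image_eqI[of _ _ "{a<..<b} - J"])
  have m: "(\<lambda>x. x) \<in> point_measure J (\<lambda>q. ennreal (d q)) \<rightarrow>\<^sub>M restrict_space borel {a<..<b}"
    using J(2) by (auto simp: point_measure_def space_restrict_space)
  have "({a<..<b} - J) \<inter> J = {}" by blast
  then have "emeasure (jump_measure {a<..<b} J d) ({a<..<b} - J) = emeasure (point_measure J (\<lambda>q. ennreal (d q))) {}"
    unfolding jump_measure_def using X m
    by (subst emeasure_distr) (auto simp: space_point_measure)
  then show ?thesis using total_variation_eq[OF ab step_has_distr_deriv[where d = d, OF assms] X] by simp
qed

section \<open>Essential limits and jumps\<close>

text \<open>A nonempty open interval to the right of \<open>x\<close> has positive measure, so it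
  cannot lie in a null set. Nontriviality of the filter makes essential limits unique.\<close>

lemma ess_at_right_neq_bot: "ess_at_right x \<noteq> bot"
proof
  assume "ess_at_right x = bot"
  then have "\<forall>\<^sub>F y in ess_at_right x. False" by simp
  then obtain A B where A: "\<forall>\<^sub>F y in at_right x. A y" and B: "AE y in lebesgue. B y" and AB: "\<And>y. A y \<Longrightarrow> B y \<Longrightarrow> False"
    unfolding eventually_inf by auto
  obtain z where z: "z > x" "\<And>y. x < y \<Longrightarrow> y < z \<Longrightarrow> A y"
    using A by (auto simp: eventually_at_right[OF less_add_one[of x]])
  have "AE y in lebesgue. y \<notin> {x<..<z}" using B by eventually_elim (use z AB in auto)
  then have "emeasure lebesgue {x<..<z} = 0"
    using AE_iff_null_sets[of "{x<..<z}" lebesgue] by auto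
  then show False using z by simp
qed

lemma ess_at_left_neq_bot: "ess_at_left x \<noteq> bot"
proof
  assume "ess_at_left x = bot"
  then have "\<forall>\<^sub>F y in ess_at_left x. False" by simp
  then obtain A B where A: "\<forall>\<^sub>F y in at_left x. A y" and B: "AE y in lebesgue. B y" and AB: "\<And>y. A y \<Longrightarrow> B y \<Longrightarrow> False"
    unfolding eventually_inf by auto
  obtain z where z: "z < x" "\<And>y. z < y \<Longrightarrow> y < x \<Longrightarrow> A y"
    using A by (auto simp: eventually_at_left[of "x - 1" x])
  have "AE y in lebesgue. y \<notin> {z<..<x}" using B by eventually_elim (use z AB in auto)
  then have "emeasure lebesgue {z<..<x} = 0"
    using AE_iff_null_sets[of "{z<..<x}" lebesgue] by auto
  then show False using z by simp
qed

text \<open>The essential filters are finer than the one-sided ones, so a function that is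
  eventually constant on each side has those constants as essential limits, and uniqueness decides
  membership in the jump set.\<close>

lemma ess_limits:
  assumes "\<forall>\<^sub>F y in at_left x. u y = l" "\<forall>\<^sub>F y in at_right x. u y = r"
  shows "Lim (ess_at_left x) u = l" "Lim (ess_at_right x) u = r" "x \<in> jump_set \<Omega> u \<longleftrightarrow> x \<in> \<Omega> \<and> l \<noteq> r"
proof -
  have t: "(u \<longlongrightarrow> l) (ess_at_left x)" "(u \<longlongrightarrow> r) (ess_at_right x)"
    by (rule tendsto_eventually[OF filter_leD[OF inf_le1 assms(1)]],
        rule tendsto_eventually[OF filter_leD[OF inf_le1 assms(2)]])
  show "Lim (ess_at_left x) u = l" "Lim (ess_at_right x) u = r"
    by (rule tendsto_Lim[OF ess_at_left_neq_bot t(1)], rule tendsto_Lim[OF ess_at_right_neq_bot t(2)])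
  show "x \<in> jump_set \<Omega> u \<longleftrightarrow> x \<in> \<Omega> \<and> l \<noteq> r"
    unfolding jump_set_def mem_Collect_eq
    using t tendsto_unique[OF ess_at_left_neq_bot t(1)] tendsto_unique[OF ess_at_right_neq_bot t(2)] by blast
qed

lemma step_at_left:
  assumes "finite J"
  shows "\<forall>\<^sub>F y in at_left x. step c J d y = step c J d x"
proof -
  have "\<forall>\<^sub>F y in at_left x. \<forall>q\<in>J. (indicator {q<..} y :: real) = indicator {q<..} x"
  proof (intro eventually_ball_finite assms ballI)
    fix q
    show "\<forall>\<^sub>F y in at_left x. (indicator {q<..} y :: real) = indicator {q<..} x"
    proof (cases "q < x")
      case True
      then show ?thesis using eventually_at_left_real[OF True] by (auto elim: eventually_mono)
    next
      case False
      then show ?thesis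
        by (auto simp: eventually_at_filter)
    qed
  qed
  then show ?thesis by eventually_elim (simp add: step_def)
qed

lemma step_at_right:
  assumes "finite J"
  shows "\<forall>\<^sub>F y in at_right x. step c J d y = step c J d x + (if x \<in> J then d x else 0)"
proof -
  have "\<forall>\<^sub>F y in at_right x. \<forall>q\<in>J. (indicator {q<..} y :: real) = indicator {q<..} x + (if q = x then 1 else 0)"
  proof (intro eventually_ball_finite assms ballI)
    fix q
    show "\<forall>\<^sub>F y in at_right x. (indicator {q<..} y :: real) = indicator {q<..} x + (if q = x then 1 else 0)"
    proof (cases "x < q")
      case True
      then show ?thesis using eventually_at_right_real[OF True] by (auto elim: eventually_mono)
    next
      case False
      then show ?thesis
        by (auto simp: eventually_at_filter)
    qed
  qed
  then show ?thesis
  proof eventually_elim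
    case (elim y)
    have "(\<Sum>q\<in>J. d q * indicator {q<..} y) = (\<Sum>q\<in>J. d q * indicator {q<..} x + (if q = x then d q else 0))"
      using elim by (intro sum.cong) (auto simp: algebra_simps)
    also have "\<dots> = (\<Sum>q\<in>J. d q * indicator {q<..} x) + (if x \<in> J then d x else 0)"
      using assms by (simp add: sum.distrib sum.delta)
    finally show ?case by (simp add: step_def)
  qed
qed

text \<open>Strict positivity of the \<open>d q\<close> makes the jump set exactly \<open>J\<close>;
  the total variation has no mass off \<open>J\<close>, so only the finite sum over the jumps
  remains.\<close>

lemma TV_K_step:
  assumes J: "finite J" "J \<subseteq> {a<..<b}" "\<And>q. q \<in> J \<Longrightarrow> 0 < d q" and ab: "a < b"
  shows "TV_K K {a<..<b} (step c J d) = (\<Sum>q\<in>J. ennreal (K (d q)))"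
proof -
  note lim = ess_limits[OF step_at_left[OF J(1)] step_at_right[OF J(1)]]
  have js: "jump_set {a<..<b} (step c J d) = J"
    using lim(3)[of _ "{a<..<b}" c d] J(2,3) by fastforce
  have "total_variation {a<..<b} (step c J d) ({a<..<b} - J) = 0"
    using J less_imp_le ab by (intro total_variation_step_off_jumps) auto
  then show ?thesis
    using J(1,3) by (simp add: TV_K_def js lim(1,2) abs_of_pos)
qed

section \<open>From piecewise constant monotone functions to step functions\<close>

text \<open>A small punctured neighbourhood of any point of \<open>\<Omega>\<close> avoids the
  finite set \<open>S\<close>; each half of it is connected and so lies in a single component. At
  points outside \<open>S\<close> the same holds for the full ball, which ties the side values to
  \<open>U x\<close>.\<close>

lemma eventually_constant_on_sides:
  assumes pc: "piecewise_constant_on \<Omega> U" and "open \<Omega>"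
  obtains S L R where "finite S" "\<And>x. x \<in> \<Omega> \<Longrightarrow> \<forall>\<^sub>F y in at_left x. U y = L x"
    "\<And>x. x \<in> \<Omega> \<Longrightarrow> \<forall>\<^sub>F y in at_right x. U y = R x"
    "\<And>x. x \<in> \<Omega> - S \<Longrightarrow> L x = U x \<and> R x = U x"
proof -
  obtain S where S: "finite S" "\<And>C. C \<in> components (\<Omega> - S) \<Longrightarrow> U constant_on C"
    using pc by (auto simp: piecewise_constant_on_def)
  have const: "\<exists>v. \<forall>y\<in>T. U y = v" if T: "T \<subseteq> \<Omega> - S" "connected T" for T
  proof (cases "T = {}")
    case False
    then obtain C where "C \<in> components (\<Omega> - S)" "T \<subseteq> C"
      using exists_component_superset[OF T(1) _ T(2)] T(1) by auto
    then show ?thesis using S(2)[of C] by (auto simp: constant_on_def)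
  qed simp
  let ?P = "\<lambda>x l r. (\<forall>\<^sub>F y in at_left x. U y = l) \<and> (\<forall>\<^sub>F y in at_right x. U y = r) \<and>
    (x \<notin> S \<longrightarrow> l = U x \<and> r = U x)"
  have "\<exists>l r. ?P x l r"
    if x: "x \<in> \<Omega>" for x
  proof -
    obtain e1 where e1: "e1 > 0" "ball x e1 \<subseteq> \<Omega>" using x \<open>open \<Omega>\<close> openE by blast
    obtain e2 where e2: "e2 > 0" "\<And>y. y \<in> S \<Longrightarrow> y \<noteq> x \<Longrightarrow> e2 \<le> dist x y" using finite_set_avoid[OF S(1), of x] by auto
    define e where "e = min e1 e2"
    have e: "e > 0" using e1 e2 by (simp add: e_def)
    have ball: "y \<in> \<Omega> \<and> (y \<noteq> x \<longrightarrow> y \<notin> S)" if "dist x y < e" for y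
      using that e1(2) e2(2)[of y] by (force simp: e_def)
    have "{x - e<..<x} \<subseteq> \<Omega> - S" "{x<..<x + e} \<subseteq> \<Omega> - S"
      using ball by (auto simp: dist_real_def)
    then obtain l r where lr: "\<forall>y\<in>{x - e<..<x}. U y = l" "\<forall>y\<in>{x<..<x + e}. U y = r"
      using const[OF _ connected_Ioo[of "x - e" x]] const[OF _ connected_Ioo[of x "x + e"]] by blast
    have "l = U x \<and> r = U x" if "x \<notin> S"
    proof -
      have "ball x e \<subseteq> \<Omega> - S" using ball that by force
      then obtain v where v: "\<forall>y\<in>ball x e. U y = v" using const[OF _ connected_ball] by blast
      have "x - e / 2 \<in> ball x e" "x + e / 2 \<in> ball x e" "x \<in> ball x e" using e by (auto simp: dist_real_def)
      then show ?thesis using v lr(1)[rule_format, of "x - e / 2"] lr(2)[rule_format, of "x + e / 2"] e by simp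
    qed
    moreover have "\<forall>\<^sub>F y in at_left x. U y = l" "\<forall>\<^sub>F y in at_right x. U y = r"
      using lr eventually_at_left_real[of "x - e" x] eventually_at_right_real[of x "x + e"] e
      by (auto elim!: eventually_mono)
    ultimately show ?thesis by blast
  qed
  then obtain L where "\<forall>x\<in>\<Omega>. \<exists>r. ?P x (L x) r" using bchoice[of \<Omega> "\<lambda>x l. \<exists>r. ?P x l r"] by blast
  then obtain R where LR: "\<forall>x\<in>\<Omega>. ?P x (L x) (R x)" using bchoice[of \<Omega> "\<lambda>x r. ?P x (L x) r"] by blast
  show thesis
    by (rule that[OF S(1), of L R]) (use LR in auto)
qed

text \<open>Subtracting all jumps leaves a function with equal one-sided limits everywhere. That
  limit is locally constant, hence constant on the connected interval. Equality holds only a.e.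
  because the values of \<open>U\<close> on the exceptional set are arbitrary.\<close>

lemma piecewise_constant_eq_step:
  assumes pc: "piecewise_constant_on {a<..<b} U" and mono: "mono_on {a<..<b} U"
    and fin: "finite (jump_set {a<..<b} U)"
  obtains c d where "AE x in lebesgue. x \<in> {a<..<b} \<longrightarrow> U x = step c (jump_set {a<..<b} U) d x"
    "\<And>q. q \<in> jump_set {a<..<b} U \<Longrightarrow> 0 < d q"
    "\<And>q. q \<in> jump_set {a<..<b} U \<Longrightarrow> Lim (at_right q) U - Lim (at_left q) U = d q"
    "\<And>q. q \<in> jump_set {a<..<b} U \<Longrightarrow> Lim (ess_at_right q) U - Lim (ess_at_left q) U = d q"
proof -
  let ?\<Omega> = "{a<..<b}"
  obtain S L R where S: "finite S" and L: "\<And>x. x \<in> ?\<Omega> \<Longrightarrow> \<forall>\<^sub>F y in at_left x. U y = L x"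
    and R: "\<And>x. x \<in> ?\<Omega> \<Longrightarrow> \<forall>\<^sub>F y in at_right x. U y = R x"
    and LR: "\<And>x. x \<in> ?\<Omega> - S \<Longrightarrow> L x = U x \<and> R x = U x"
    using eventually_constant_on_sides[OF pc] by (metis open_greaterThanLessThan)
  define J where "J = jump_set ?\<Omega> U"
  define d where "d x = R x - L x" for x
  \<comment> \<open>The limit of \<open>U - step 0 J d\<close> at \<open>x\<close>, not its value,
    so that exceptional values of \<open>U\<close> do not enter.\<close>
  define w where "w x = L x - step 0 J d x" for x
  have J: "x \<in> J \<longleftrightarrow> x \<in> ?\<Omega> \<and> L x \<noteq> R x" for x
  proof (cases "x \<in> ?\<Omega>")
    case True
    then show ?thesis using ess_limits(3)[OF L R] by (simp add: J_def)
  qed (auto simp: J_def jump_set_def)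
  have finJ: "finite J" using fin by (simp add: J_def)
  have le: "L x \<le> R x" if x: "x \<in> ?\<Omega>" for x
  proof -
    have "\<forall>\<^sub>F y in at_left x. U y = L x \<and> y \<in> {a<..<x}"
      using x by (intro eventually_conj L eventually_at_left_real) auto
    then obtain y where "U y = L x" "y \<in> {a<..<x}"
      using eventually_happens'[OF trivial_limit_at_left_real] by blast
    moreover have "\<forall>\<^sub>F y in at_right x. U y = R x \<and> y \<in> {x<..<b}"
      using x by (intro eventually_conj R eventually_at_right_real) auto
    then obtain z where "U z = R x" "z \<in> {x<..<b}"
      using eventually_happens'[OF trivial_limit_at_right_real] by blast
    ultimately show ?thesis using mono_onD[OF mono, of y z] x by auto
  qed
  have w_at: "\<forall>\<^sub>F y in at x. U y - step 0 J d y = w x" if x: "x \<in> ?\<Omega>" for x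
  proof -
    have "\<forall>\<^sub>F y in at_left x. U y - step 0 J d y = w x"
      using L[OF x] step_at_left[OF finJ, where x = x and c = 0 and d = d] by eventually_elim (simp add: w_def)
    moreover have "\<forall>\<^sub>F y in at_right x. U y - step 0 J d y = w x"
      using R[OF x] step_at_right[OF finJ, where x = x and c = 0 and d = d] by eventually_elim (use J x in \<open>auto simp: w_def d_def split: if_splits\<close>)
    ultimately show ?thesis by (simp add: eventually_at_split)
  qed
  have "w constant_on ?\<Omega>"
  proof (rule locally_constant_imp_constant)
    fix x assume x: "x \<in> ?\<Omega>"
    obtain T where T: "open T" "x \<in> T" "\<And>y. y \<in> T \<Longrightarrow> y \<noteq> x \<Longrightarrow> U y - step 0 J d y = w x"
      using w_at[OF x] by (auto simp: eventually_at_topological)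
    have eq: "w y = w x" if y: "y \<in> T \<inter> ?\<Omega>" for y
    proof (cases "y = x")
      case False
      \<comment> \<open>Points \<open>z\<close> near \<open>y\<close> still lie in \<open>T\<close>
        and avoid \<open>x\<close>; there \<open>U - step 0 J d\<close> equals both
        \<open>w x\<close> and \<open>w y\<close>.\<close>
      have "\<forall>\<^sub>F z in at y. z \<in> T \<and> z \<noteq> x"
        using T(1) y False eventually_at_in_open'[of "T - {x}" y] by (auto simp: open_delete elim: eventually_mono)
      then have "\<forall>\<^sub>F z in at y. w y = w x"
        using w_at[of y, OF IntD2[OF y]] by eventually_elim (use T(3) in auto)
      then show ?thesis by simp
    qed simp
    show "\<exists>T. openin (top_of_set ?\<Omega>) T \<and> x \<in> T \<and> (\<forall>y\<in>T. w y = w x)"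
    proof (intro exI conjI ballI)
      show "openin (top_of_set ?\<Omega>) (?\<Omega> \<inter> T)" by (rule openin_open_Int[OF T(1)])
      show "x \<in> ?\<Omega> \<inter> T" using x T(2) by (rule IntI)
      show "w y = w x" if "y \<in> ?\<Omega> \<inter> T" for y by (rule eq) (use that in blast)
    qed
  qed simp
  then obtain c where c: "\<And>x. x \<in> ?\<Omega> \<Longrightarrow> w x = c" by (auto simp: constant_on_def)
  have "U x = step c J d x" if "x \<in> ?\<Omega> - S" for x
    using LR[OF that] c[of x] that by (auto simp: w_def step_def)
  moreover have "AE x in lebesgue. x \<notin> S"
    using finite_imp_null_set_lborel[OF S] by (intro AE_not_in null_sets_completionI)
  ultimately have AE: "AE x in lebesgue. x \<in> ?\<Omega> \<longrightarrow> U x = step c J d x" by (auto elim: eventually_mono)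
  show thesis
  proof (rule that[of c d])
    fix q assume "q \<in> jump_set ?\<Omega> U"
    then have q: "q \<in> ?\<Omega>" "L q \<noteq> R q" using J[of q] by (auto simp: J_def)
    then show "0 < d q" using le[of q] by (auto simp: d_def)
    show "Lim (ess_at_right q) U - Lim (ess_at_left q) U = d q"
      using ess_limits[OF L R] q by (simp add: d_def)
    show "Lim (at_right q) U - Lim (at_left q) U = d q"
      using tendsto_Lim[OF _ tendsto_eventually[OF L[OF q(1)]]] tendsto_Lim[OF _ tendsto_eventually[OF R[OF q(1)]]]
      by (simp add: d_def)
  qed (use AE in \<open>simp add: J_def\<close>)
qed

section \<open>Comparison of adjacent jumps\<close>

text \<open>The integral of \<open>(u - (k z + l))\<^sup>2\<close> over \<open>[\<alpha>, \<beta>]\<close> for the function \<open>u\<close> with value \<open>c\<close> at \<open>\<alpha>\<close> and jumps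
  of size \<open>x\<close> at \<open>P\<close> and \<open>y\<close> at \<open>Q\<close>; on each plateau \<open>v\<close> a primitive is \<open>- (v - (k z + l))\<^sup>3 / (3 k)\<close>.\<close>

definition two_jump_fidelity ::
    "real \<Rightarrow> real \<Rightarrow> real \<Rightarrow> real \<Rightarrow> real \<Rightarrow> real \<Rightarrow> real \<Rightarrow> real \<Rightarrow> real \<Rightarrow> real" where
  "two_jump_fidelity k l \<alpha> \<beta> c x y P Q =
     ((c - (k * \<alpha> + l)) ^ 3 - (c - (k * P + l)) ^ 3
      + (c + x - (k * P + l)) ^ 3 - (c + x - (k * Q + l)) ^ 3
      + (c + x + y - (k * Q + l)) ^ 3 - (c + x + y - (k * \<beta> + l)) ^ 3) / (3 * k)"

lemma two_jump_stationary:
  fixes k l lam x y p q \<alpha> \<beta> c :: real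
  defines "H \<equiv> \<lambda>P Q t. (x + t) / (1 + (x + t)) + (y - t) / (1 + (y - t))
    + lam / 2 * two_jump_fidelity k l \<alpha> \<beta> c (x + t) (y - t) P Q"
  assumes pos: "k > 0" "lam > 0" "x > 0" "y > 0" and order: "\<alpha> < p" "p < q" "q < \<beta>"
    and min: "\<And>P Q t. \<alpha> < P \<Longrightarrow> P < Q \<Longrightarrow> Q < \<beta> \<Longrightarrow> - x < t \<Longrightarrow> t < y \<Longrightarrow> H p q 0 \<le> H P Q t"
  shows "x = y \<and> q - p = x / k"
proof -
  \<comment> \<open>Moving one jump by less than \<open>e\<close> preserves the order of
    \<open>\<alpha>\<close>, \<open>p\<close>, \<open>q\<close> and \<open>\<beta>\<close>.\<close>
  define e where "e = min (min (p - \<alpha>) (q - p)) (\<beta> - q)"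
  have e: "e > 0" "e \<le> p - \<alpha>" "e \<le> q - p" "e \<le> \<beta> - q" using order by (auto simp: e_def)
  have gp: "k * p + l = c + x / 2"
  proof -
    have "DERIV (\<lambda>P. H P q 0) p :> lam / 2 * ((3 * k * (c - (k * p + l)) ^ 2 - 3 * k * (c + x - (k * p + l)) ^ 2) / (3 * k))"
      unfolding H_def two_jump_fidelity_def using pos
      by (auto intro!: derivative_eq_intros simp: field_simps)
    moreover have "\<forall>P. \<bar>p - P\<bar> < e \<longrightarrow> H p q 0 \<le> H P q 0"
      using e order pos by (auto intro!: min simp: abs_less_iff)
    ultimately have "lam / 2 * ((3 * k * (c - (k * p + l)) ^ 2 - 3 * k * (c + x - (k * p + l)) ^ 2) / (3 * k)) = 0"
      using DERIV_local_min e(1) by blast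
    then have "(c - (k * p + l)) ^ 2 = (c + x - (k * p + l)) ^ 2" using pos by simp
    then have "x * (x + 2 * (c - (k * p + l))) = 0" by (simp add: power2_eq_square algebra_simps)
    then show ?thesis using pos by simp
  qed
  have gq: "k * q + l = c + x + y / 2"
  proof -
    have "DERIV (\<lambda>Q. H p Q 0) q :> lam / 2 * ((3 * k * (c + x - (k * q + l)) ^ 2 - 3 * k * (c + x + y - (k * q + l)) ^ 2) / (3 * k))"
      unfolding H_def two_jump_fidelity_def using pos
      by (auto intro!: derivative_eq_intros simp: field_simps)
    moreover have "\<forall>Q. \<bar>q - Q\<bar> < e \<longrightarrow> H p q 0 \<le> H p Q 0"
      using e order pos by (auto intro!: min simp: abs_less_iff)
    ultimately have "lam / 2 * ((3 * k * (c + x - (k * q + l)) ^ 2 - 3 * k * (c + x + y - (k * q + l)) ^ 2) / (3 * k)) = 0"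
      using DERIV_local_min e(1) by blast
    then have "(c + x - (k * q + l)) ^ 2 = (c + x + y - (k * q + l)) ^ 2" using pos by simp
    then have "y * (y + 2 * (c + x - (k * q + l))) = 0" by (simp add: power2_eq_square algebra_simps)
    then show ?thesis using pos by simp
  qed
  \<comment> \<open>With this normalization the cubic term of \<open>G\<close> is \<mu> \<rho>^3 /
    3, with derivative \<mu> \<rho>^2.\<close>
  define \<mu> where "\<mu> = lam / (8 * k)"
  text \<open>\<open>t * \<psi> t\<close> is the energy difference \<open>G (x + t) + G (y - t) - G x - G y\<close>, and \<open>\<zeta> t = \<psi> t / t\<close>
    below.\<close>
  define \<psi> where "\<psi> t = 1 / ((1 + x) * (1 + x + t)) - 1 / ((1 + y) * (1 + y - t))
    + \<mu> * (x\<^sup>2 - y\<^sup>2) + \<mu> * t * (x + y)" for t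
  \<comment> \<open>For \<open>\<bar>t\<bar> < r\<close> both jump sizes stay positive and the
    displacement \<open>t / (2 * k)\<close> stays below \<open>e\<close>; the equal displacement of
    both jumps keeps their order.\<close>
  define r where "r = Min {x, y, 2 * k * e}"
  have r: "r > 0" "r \<le> x" "r \<le> y" "r \<le> 2 * k * e" using pos e by (auto simp: r_def)
  have t_psi: "t * \<psi> t \<ge> 0" if t: "\<bar>t\<bar> < r" for t
  proof -
    have t': "1 + x + t \<noteq> 0" "1 + y - t \<noteq> 0" "1 + x \<noteq> 0" "1 + y \<noteq> 0" using t r pos by auto
    have "\<bar>t / (2 * k)\<bar> < e" using t r pos by (simp add: abs_divide field_simps)
    then have "\<alpha> < p + t / (2 * k)" "q + t / (2 * k) < \<beta>"
      using e by linarith+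
    then have le: "H p q 0 \<le> H (p + t / (2 * k)) (q + t / (2 * k)) t"
      using order t r by (intro min) auto
    have *: "k * (p + t / (2 * k)) + l = c + x / 2 + t / 2" "k * (q + t / (2 * k)) + l = c + x + y / 2 + t / 2" for t
    proof -
      have "k * (t / (2 * k)) = t / 2" using pos by simp
      then show "k * (p + t / (2 * k)) + l = c + x / 2 + t / 2" "k * (q + t / (2 * k)) + l = c + x + y / 2 + t / 2"
        using gp gq by (simp_all add: distrib_left)
    qed
    \<comment> \<open>The outer plateaus do not change, so the terms at \<open>\<alpha>\<close> and
      \<open>\<beta>\<close> cancel. A jump of size \<rho> at its midpoint contributes two cubes of
      \<rho> / 2, that is \<rho>^3 / (12 k).\<close>
    have F: "two_jump_fidelity k l \<alpha> \<beta> c (x + t) (y - t) (p + t / (2 * k)) (q + t / (2 * k)) =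
      two_jump_fidelity k l \<alpha> \<beta> c x y p q + ((x + t) ^ 3 - x ^ 3 + (y - t) ^ 3 - y ^ 3) / (12 * k)"
      unfolding two_jump_fidelity_def * gp gq using pos by (simp add: field_simps power3_eq_cube)
    have mu: "lam / 2 * (D / (12 * k)) = \<mu> / 3 * D" for D by (simp add: \<mu>_def)
    have "H (p + t / (2 * k)) (q + t / (2 * k)) t - H p q 0 =
      ((x + t) / (1 + (x + t)) - x / (1 + x)) + ((y - t) / (1 + (y - t)) - y / (1 + y))
      + \<mu> / 3 * ((x + t) ^ 3 - x ^ 3 + (y - t) ^ 3 - y ^ 3)"
      unfolding H_def F distrib_left mu by simp
    also have "(x + t) / (1 + (x + t)) - x / (1 + x) = t * (1 / ((1 + x) * (1 + x + t)))"
      using t' by (simp add: field_simps)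
    also have "(y - t) / (1 + (y - t)) - y / (1 + y) = - t * (1 / ((1 + y) * (1 + y - t)))"
      using t' by (simp add: field_simps)
    also have "\<mu> / 3 * ((x + t) ^ 3 - x ^ 3 + (y - t) ^ 3 - y ^ 3) = t * (\<mu> * (x\<^sup>2 - y\<^sup>2) + \<mu> * t * (x + y))"
      by (simp add: power3_eq_cube power2_eq_square algebra_simps)
    finally show ?thesis using le by (simp add: \<psi>_def algebra_simps)
  qed
  \<comment> \<open>First-order condition: \<open>t * \<psi> t \<ge> 0\<close> on both sides of 0
    makes \<open>\<psi>\<close> change sign there, and \<open>\<psi>\<close> is continuous at
    0.\<close>
  have psi0: "\<psi> 0 = 0"
  proof -
    have c: "(\<psi> \<longlongrightarrow> \<psi> 0) (at 0 within A)" for A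
      unfolding \<psi>_def using pos by (intro tendsto_intros) auto
    have "\<forall>\<^sub>F t in at_right 0. 0 \<le> \<psi> t"
      using eventually_at_right_real[OF r(1)]
    proof eventually_elim
      case (elim t)
      then show ?case using t_psi[of t] by (simp add: zero_le_mult_iff)
    qed
    then have "0 \<le> \<psi> 0" by (intro tendsto_lowerbound[OF c[of "{0<..}"]]) auto
    have "- r < 0" using r(1) by simp
    have "\<forall>\<^sub>F t in at_left 0. \<psi> t \<le> 0"
      using eventually_at_left_real[OF \<open>- r < 0\<close>]
    proof eventually_elim
      case (elim t)
      then show ?case using t_psi[of t] by (simp add: zero_le_mult_iff)
    qed
    then have "\<psi> 0 \<le> 0" by (intro tendsto_upperbound[OF c[of "{..<0}"]]) auto
    then show ?thesis using \<open>0 \<le> \<psi> 0\<close> by simp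
  qed
  define \<zeta> where "\<zeta> t = \<mu> * (x + y) - 1 / ((1 + x)\<^sup>2 * (1 + x + t)) - 1 / ((1 + y)\<^sup>2 * (1 + y - t))" for t
  \<comment> \<open>Second-order condition without second derivatives: since
    \<open>\<psi> 0 = 0\<close>, the nonnegative energy difference is t^2 times
    \<open>\<zeta> t\<close>; let t tend to 0 from the right.\<close>
  have "0 \<le> \<zeta> 0"
  proof (rule tendsto_lowerbound)
    show "(\<zeta> \<longlongrightarrow> \<zeta> 0) (at_right 0)"
      unfolding \<zeta>_def using pos by (intro tendsto_intros) auto
    have "0 \<le> \<zeta> t" if t: "0 < t" "t < r" for t
    proof -
      have t': "1 + x + t \<noteq> 0" "1 + y - t \<noteq> 0" "1 + x \<noteq> 0" "1 + y \<noteq> 0" using t r pos by auto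
      have "1 / ((1 + x) * (1 + x + t)) = 1 / (1 + x)\<^sup>2 - t / ((1 + x)\<^sup>2 * (1 + x + t))"
        "1 / ((1 + y) * (1 + y - t)) = 1 / (1 + y)\<^sup>2 + t / ((1 + y)\<^sup>2 * (1 + y - t))"
        using t' by (simp_all add: divide_simps) (simp_all add: power2_eq_square algebra_simps)
      then have "\<psi> t - \<psi> 0 = t * \<zeta> t" unfolding \<psi>_def \<zeta>_def by (simp add: algebra_simps power2_eq_square)
      then have "0 \<le> t * (t * \<zeta> t)" using t_psi[of t] psi0 t by simp
      then show ?thesis using t by (simp add: zero_le_mult_iff)
    qed
    then show "\<forall>\<^sub>F t in at_right 0. 0 \<le> \<zeta> t"
      by (intro eventually_mono[OF eventually_at_right_real[OF r(1)]]) simp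
  qed simp
  have "x = y"
  proof (rule ccontr)
    assume ne: "x \<noteq> y"
    define A B where "A = 1 / (1 + x)" and "B = 1 / (1 + y)"
    have AB: "A > 0" "B > 0" "x = 1 / A - 1" "y = 1 / B - 1" using pos by (auto simp: A_def B_def)
    have "\<psi> 0 = A\<^sup>2 - B\<^sup>2 + \<mu> * (x\<^sup>2 - y\<^sup>2)" by (simp add: \<psi>_def A_def B_def power2_eq_square)
    moreover have "x - y = (B - A) / (A * B)" unfolding AB(3,4) using AB(1,2) by (simp add: field_simps)
    then have "x\<^sup>2 - y\<^sup>2 = (B - A) / (A * B) * (x + y)" by (simp add: power2_eq_square algebra_simps flip: \<open>x - y = _\<close>)
    \<comment> \<open>Dividing by \<open>B - A\<close> solves for \<open>\<mu> * (x + y)\<close>.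
      Inserted into \<open>\<zeta> 0\<close> this removes \<open>\<mu>\<close> and leaves A B (A +
      B) - A^3 - B^3 = - (A + B) (A - B)^2.\<close>
    ultimately have "0 = (B - A) * (\<mu> * (x + y) / (A * B) - (A + B))"
      using psi0 by (simp add: power2_eq_square algebra_simps)
    moreover have "B \<noteq> A" using ne AB(3,4) by auto
    ultimately have "\<mu> * (x + y) / (A * B) = A + B" by simp
    then have "\<mu> * (x + y) = A * B * (A + B)" using AB(1,2) by (simp add: nonzero_divide_eq_eq mult_ac)
    moreover have "\<zeta> 0 = \<mu> * (x + y) - A ^ 3 - B ^ 3" by (simp add: \<zeta>_def A_def B_def power2_eq_square power3_eq_cube)
    ultimately have "0 \<le> - ((A + B) * (A - B)\<^sup>2)" using \<open>0 \<le> \<zeta> 0\<close>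
      by (simp add: power2_eq_square power3_eq_cube algebra_simps)
    moreover have "(A + B) * (A - B)\<^sup>2 > 0" using AB \<open>B \<noteq> A\<close> by (intro mult_pos_pos) auto
    ultimately show False by linarith
  qed
  moreover have "k * (q - p) = (x + y) / 2" using gp gq by (simp add: algebra_simps)
  ultimately show ?thesis using pos by (simp add: field_simps)
qed

section \<open>The fidelity integral, localized to subsets of the interval\<close>

definition fidelity :: "(real \<Rightarrow> real) \<Rightarrow> real set \<Rightarrow> (real \<Rightarrow> real) \<Rightarrow> ennreal" where
  "fidelity g A u = (\<integral>\<^sup>+x\<in>A. ennreal (\<bar>u x - g x\<bar>\<^sup>2) \<partial>lebesgue)"

lemma step_insert:
  assumes "finite J" "q \<notin> J"
  shows "step c (insert q J) d x = step c J d x + d q * indicator {q<..} x"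
  unfolding step_def sum.insert[OF assms] by (simp only: add_ac)

lemma step_cong:
  assumes "\<And>q. q \<in> J \<Longrightarrow> d q = d' q"
  shows "step c J d = step c J d'"
  using assms by (auto simp: step_def fun_eq_iff intro!: sum.cong)

lemma step_constant_between_jumps:
  assumes "J \<inter> {\<alpha>..\<beta>} = {}" "x \<in> {\<alpha>..\<beta>}"
  shows "step c J d x = step c J d \<alpha>"
  using assms unfolding step_def
  by (intro arg_cong2[where f = "(+)"] refl sum.cong) (force simp: indicator_def)

lemma has_integral_square_affine:
  fixes k l c s t :: real
  assumes "k > 0" "s \<le> t"
  shows "((\<lambda>x. (c - (k * x + l)) ^ 2) has_integral ((c - (k * s + l)) ^ 3 - (c - (k * t + l)) ^ 3) / (3 * k)) {s..t}"
proof -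
  have "((\<lambda>x. (c - (k * x + l)) ^ 2) has_integral
    - ((c - (k * t + l)) ^ 3 / (3 * k)) - (- ((c - (k * s + l)) ^ 3 / (3 * k)))) {s..t}"
    using assms
    by (intro fundamental_theorem_of_calculus)
       (auto intro!: derivative_eq_intros simp flip: has_real_derivative_iff_has_vector_derivative)
  then show ?thesis by (simp add: diff_divide_distrib)
qed

lemma two_jump_has_integral:
  assumes k: "k > 0" and order: "\<alpha> < P" "P < Q" "Q < \<beta>"
  shows "((\<lambda>z. (c + x * indicator {P<..} z + y * indicator {Q<..} z - (k * z + l)) ^ 2)
    has_integral two_jump_fidelity k l \<alpha> \<beta> c x y P Q) {\<alpha>..\<beta>}" (is "(?f has_integral _) _")
proof -
  have 1: "(?f has_integral ((c - (k * \<alpha> + l)) ^ 3 - (c - (k * P + l)) ^ 3) / (3 * k)) {\<alpha>..P}"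
    by (rule has_integral_spike[OF negligible_empty _ has_integral_square_affine[OF k, where c = c]])
       (use order in auto)
  \<comment> \<open>At its left endpoint the integrand still has the value of the previous plateau,
    so this single point is treated as negligible.\<close>
  have 2: "(?f has_integral ((c + x - (k * P + l)) ^ 3 - (c + x - (k * Q + l)) ^ 3) / (3 * k)) {P..Q}"
    by (rule has_integral_spike[OF negligible_sing[of P] _ has_integral_square_affine[OF k, where c = "c + x"]])
       (use order in auto)
  have 3: "(?f has_integral ((c + x + y - (k * Q + l)) ^ 3 - (c + x + y - (k * \<beta> + l)) ^ 3) / (3 * k)) {Q..\<beta>}"
    by (rule has_integral_spike[OF negligible_sing[of Q] _ has_integral_square_affine[OF k, where c = "c + x + y"]])
       (use order in auto)
  show ?thesis
    using has_integral_combine[OF _ _ has_integral_combine[OF _ _ 1 2] 3] order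
    by (simp add: two_jump_fidelity_def add_divide_distrib diff_divide_distrib algebra_simps)
qed

lemma two_jump_fidelity_nonneg:
  assumes "k > 0" "\<alpha> < P" "P < Q" "Q < \<beta>"
  shows "0 \<le> two_jump_fidelity k l \<alpha> \<beta> c x y P Q"
  by (rule has_integral_nonneg[OF two_jump_has_integral[OF assms]]) auto

lemma fidelity_two_jump:
  assumes "k > 0" "\<alpha> < P" "P < Q" "Q < \<beta>"
    and g: "\<And>z. z \<in> {\<alpha>..\<beta>} \<Longrightarrow> g z = k * z + l"
    and u: "\<And>z. z \<in> {\<alpha>..\<beta>} \<Longrightarrow> u z = c + x * indicator {P<..} z + y * indicator {Q<..} z"
  shows "fidelity g {\<alpha>..\<beta>} u = ennreal (two_jump_fidelity k l \<alpha> \<beta> c x y P Q)"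
proof -
  let ?f = "\<lambda>z. (c + x * indicator {P<..} z + y * indicator {Q<..} z - (k * z + l)) ^ 2"
  have "fidelity g {\<alpha>..\<beta>} u = (\<integral>\<^sup>+z. ennreal (?f z) * indicator {\<alpha>..\<beta>} z \<partial>lebesgue)"
    unfolding fidelity_def by (intro nn_integral_cong) (simp add: g u split: split_indicator)
  also have "\<dots> = (\<integral>\<^sup>+z. ennreal (?f z) * indicator {\<alpha>..\<beta>} z \<partial>lborel)"
    by (rule nn_integral_completion)
  also have "\<dots> = ennreal (two_jump_fidelity k l \<alpha> \<beta> c x y P Q)"
    by (rule nn_integral_has_integral_lebesgue'[OF _ two_jump_has_integral[OF assms(1-4)]]) auto
  finally show ?thesis .
qed

lemma fidelity_cong:
  assumes "\<And>x. x \<in> A \<Longrightarrow> u x = v x" "\<And>x. x \<in> A \<Longrightarrow> g x = h x"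
  shows "fidelity g A u = fidelity h A v"
  unfolding fidelity_def using assms by (intro nn_integral_cong) (simp split: split_indicator)

lemma fidelity_split:
  assumes [measurable]: "u \<in> borel_measurable borel" "A \<in> sets borel" "B \<in> sets borel"
    and AB: "B \<subseteq> A" and g: "\<And>x. x \<in> A \<Longrightarrow> g x = k * x + l"
  shows "fidelity g A u = fidelity g (A - B) u + fidelity g B u"
proof -
  \<comment> \<open>\<open>g\<close> is known only on \<open>A\<close> and may fail to be measurable
    elsewhere, so the splitting is done with the affine function and translated back.\<close>
  let ?h = "\<lambda>x. k * x + l"
  have m: "(\<lambda>x. ennreal (\<bar>u x - ?h x\<bar>\<^sup>2) * indicator X x) \<in> borel_measurable lebesgue" if [measurable]: "X \<in> sets borel" for X
    by (rule measurable_completion) measurable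
  have "fidelity ?h A u = (\<integral>\<^sup>+x. ennreal (\<bar>u x - ?h x\<bar>\<^sup>2) * indicator (A - B) x + ennreal (\<bar>u x - ?h x\<bar>\<^sup>2) * indicator B x \<partial>lebesgue)"
    unfolding fidelity_def using AB by (intro nn_integral_cong) (auto split: split_indicator)
  also have "\<dots> = fidelity ?h (A - B) u + fidelity ?h B u"
    unfolding fidelity_def by (intro nn_integral_add m) measurable
  also have "fidelity ?h A u = fidelity g A u" by (intro fidelity_cong) (simp_all add: g)
  also have "fidelity ?h (A - B) u = fidelity g (A - B) u" by (intro fidelity_cong) (simp_all add: g)
  also have "fidelity ?h B u = fidelity g B u" using AB by (intro fidelity_cong) (auto simp: g)
  finally show ?thesis .
qed

lemma fidelity_finite:
  assumes bnd: "\<And>x. x \<in> {a<..<b} \<Longrightarrow> \<bar>u x\<bar> \<le> C" and g: "\<And>x. x \<in> {a<..<b} \<Longrightarrow> g x = k * x + l"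
    and A: "A \<subseteq> {a<..<b}"
  shows "fidelity g A u < \<infinity>"
proof -
  define M where "M = C + \<bar>k\<bar> * (\<bar>a\<bar> + \<bar>b\<bar>) + \<bar>l\<bar>"
  have "\<bar>u x - g x\<bar>\<^sup>2 \<le> M\<^sup>2" if x: "x \<in> {a<..<b}" for x
  proof (rule power_mono)
    have "\<bar>k * x\<bar> \<le> \<bar>k\<bar> * (\<bar>a\<bar> + \<bar>b\<bar>)" unfolding abs_mult using x by (intro mult_left_mono) auto
    then show "\<bar>u x - g x\<bar> \<le> M" using bnd[OF x] unfolding g[OF x] M_def by linarith
  qed simp
  then have "fidelity g A u \<le> (\<integral>\<^sup>+x. ennreal (M\<^sup>2) * indicator {a<..<b} x \<partial>lebesgue)"
    unfolding fidelity_def using A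
    by (intro nn_integral_mono) (auto split: split_indicator intro!: ennreal_leI)
  also have "\<dots> = ennreal (M\<^sup>2) * emeasure lebesgue {a<..<b}"
    by (subst nn_integral_cmult_indicator) auto
  also have "\<dots> < \<infinity>"
    by (cases "a \<le> b") (auto simp: ennreal_mult_less_top)
  finally show ?thesis .
qed

section \<open>Competitors that alter two neighbouring jumps\<close>

text \<open>Reduces minimality over \<open>BV\<close> to the three real parameters of
  \<open>two_jump_stationary\<close>: the competitors \<open>V P Q t\<close> differ from the step
  representative of \<open>U\<close> only inside \<open>{\<alpha>..\<beta>}\<close>, and everything
  else in the energy cancels.\<close>

lemma adjacent_jumps:
  fixes a b lam k l p q :: real and g K U :: "real \<Rightarrow> real"
  assumes ab: "a < b" and lam: "lam > 0"
    and k: "k > 0" and g: "\<And>x. x \<in> {a<..<b} \<Longrightarrow> g x = k * x + l"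
    and K: "\<And>\<rho>. \<rho> \<ge> 0 \<Longrightarrow> K \<rho> = \<rho> / (1 + \<rho>)"
    and minimizer: "TV_Kg_minimizer K lam g {a<..<b} U"
    and J: "jump_set {a<..<b} U = J" "finite J"
    and U: "AE x in lebesgue. x \<in> {a<..<b} \<longrightarrow> U x = step c J d x"
    and d: "\<And>q. q \<in> J \<Longrightarrow> 0 < d q" "\<And>q. q \<in> J \<Longrightarrow> Lim (ess_at_right q) U - Lim (ess_at_left q) U = d q"
    and adj: "p \<in> J" "q \<in> J" "p < q" "J \<inter> {p<..<q} = {}"
  shows "d p = d q \<and> q - p = d p / k"
proof -
  let ?\<Omega> = "{a<..<b}"
  define I where "I = J - {p, q}"
  have J_sub: "J \<subseteq> ?\<Omega>" using J(1) by (auto simp: jump_set_def)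
  have I: "finite I" "I \<subseteq> ?\<Omega>" "p \<notin> I" "q \<notin> I" "J = insert p (insert q I)" using J adj J_sub by (auto simp: I_def)
  obtain e where e: "e > 0" "\<And>z. z \<in> insert a (insert b I) \<Longrightarrow> e \<le> dist p z" "\<And>z. z \<in> insert a (insert b I) \<Longrightarrow> e \<le> dist q z"
  proof -
    have f: "finite (insert a (insert b I))" using I(1) by simp
    obtain e1 where e1: "e1 > 0" "\<And>z. z \<in> insert a (insert b I) \<Longrightarrow> z \<noteq> p \<Longrightarrow> e1 \<le> dist p z"
      using finite_set_avoid[OF f, of p] by auto
    obtain e2 where e2: "e2 > 0" "\<And>z. z \<in> insert a (insert b I) \<Longrightarrow> z \<noteq> q \<Longrightarrow> e2 \<le> dist q z"
      using finite_set_avoid[OF f, of q] by auto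
    have "z \<noteq> p \<and> z \<noteq> q" if "z \<in> insert a (insert b I)" for z
      using that I(3,4) J_sub adj(1,2) by auto
    then show thesis using that[of "min e1 e2"] e1 e2 by (simp add: min_le_iff_disj)
  qed
  \<comment> \<open>Half the distance to the other jumps and the endpoints keeps the closed window
    inside \<open>?\<Omega>\<close> and free of \<open>I\<close>; between \<open>p\<close> and
    \<open>q\<close> adjacency is what excludes other jumps.\<close>
  define \<alpha> \<beta> where "\<alpha> = p - e / 2" and "\<beta> = q + e / 2"
  have pq: "a < p" "p < b" "a < q" "q < b" using J_sub adj by auto
  have order: "a < \<alpha>" "\<alpha> < p" "q < \<beta>" "\<beta> < b"
    using e(1) e(2)[of a] e(3)[of b] pq by (auto simp: \<alpha>_def \<beta>_def dist_real_def)
  have I_sep: "I \<inter> {\<alpha>..\<beta>} = {}"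
  proof -
    have "z \<notin> {\<alpha>..\<beta>}" if z: "z \<in> I" for z
    proof -
      have "z \<notin> {p<..<q}" using adj(4) z I(5) by auto
      then show ?thesis using e(1) e(2)[of z] e(3)[of z] z by (auto simp: \<alpha>_def \<beta>_def dist_real_def)
    qed
    then show ?thesis by auto
  qed
  have sub: "{\<alpha>..\<beta>} \<subseteq> ?\<Omega>" using order by auto
  define c0 where "c0 = step c I d \<alpha>"
  define x y where "x = d p" and "y = d q"
  have xy: "x > 0" "y > 0" using d(1) adj by (auto simp: x_def y_def)
  define V where "V P Q t z = step c I d z + (x + t) * indicator {P<..} z + (y - t) * indicator {Q<..} z" for P Q t z
  define Kr where "Kr = (\<Sum>z\<in>I. ennreal (K (d z)))"
  define Fr where "Fr = fidelity g (?\<Omega> - {\<alpha>..\<beta>}) (V p q 0)"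
  define H where "H P Q t = (x + t) / (1 + (x + t)) + (y - t) / (1 + (y - t))
    + lam / 2 * two_jump_fidelity k l \<alpha> \<beta> c0 (x + t) (y - t) P Q" for P Q t
  have V_fid: "ennreal (K (x + t)) + (ennreal (K (y - t)) + Kr) + ennreal (lam / 2) * fidelity g ?\<Omega> (V P Q t) =
      (Kr + ennreal (lam / 2) * Fr) + ennreal (H P Q t)" and H_nonneg: "0 \<le> H P Q t"
    if v: "\<alpha> < P" "P < Q" "Q < \<beta>" "- x < t" "t < y" for P Q t
  proof -
    have m: "V P Q t \<in> borel_measurable borel" unfolding V_def by measurable
    have "fidelity g ?\<Omega> (V P Q t) = fidelity g (?\<Omega> - {\<alpha>..\<beta>}) (V P Q t) + fidelity g {\<alpha>..\<beta>} (V P Q t)"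
      by (rule fidelity_split[OF m _ _ sub g]) auto
    \<comment> \<open>Left of \<open>\<alpha>\<close> neither jump has occurred; right of
      \<open>\<beta>\<close> both have, and their total \<open>(x + t) + (y - t)\<close> does not
      depend on \<open>t\<close>.\<close>
    also have "fidelity g (?\<Omega> - {\<alpha>..\<beta>}) (V P Q t) = Fr"
      unfolding Fr_def using v order adj(3) by (intro fidelity_cong) (auto simp: V_def indicator_def)
    also have "fidelity g {\<alpha>..\<beta>} (V P Q t) = ennreal (two_jump_fidelity k l \<alpha> \<beta> c0 (x + t) (y - t) P Q)"
    proof (rule fidelity_two_jump[OF k v(1-3)])
      fix z assume z: "z \<in> {\<alpha>..\<beta>}"
      show "g z = k * z + l" by (rule g[OF subsetD[OF sub z]])
      show "V P Q t z = c0 + (x + t) * indicator {P<..} z + (y - t) * indicator {Q<..} z"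
        unfolding V_def c0_def step_constant_between_jumps[OF I_sep z] ..
    qed
    finally have F: "fidelity g ?\<Omega> (V P Q t) = Fr + ennreal (two_jump_fidelity k l \<alpha> \<beta> c0 (x + t) (y - t) P Q)" .
    note nn = two_jump_fidelity_nonneg[OF k v(1-3), of l c0 "x + t" "y - t"]
    have Kxy: "0 \<le> (x + t) / (1 + (x + t))" "0 \<le> (y - t) / (1 + (y - t))" using v by auto
    show "0 \<le> H P Q t" unfolding H_def using nn Kxy lam by (intro add_nonneg_nonneg mult_nonneg_nonneg) auto
    have "ennreal (H P Q t) = ennreal (K (x + t)) + ennreal (K (y - t)) +
      ennreal (lam / 2) * ennreal (two_jump_fidelity k l \<alpha> \<beta> c0 (x + t) (y - t) P Q)"
    proof -
      have "ennreal (A + B + lam / 2 * C) = ennreal A + ennreal B + ennreal (lam / 2) * ennreal C"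
        if "0 \<le> A" "0 \<le> B" "0 \<le> C" for A B C
        using that lam by (simp flip: ennreal_plus ennreal_mult)
      moreover have "K (x + t) = (x + t) / (1 + (x + t))" "K (y - t) = (y - t) / (1 + (y - t))"
        using v by (auto intro!: K)
      ultimately show ?thesis unfolding H_def using Kxy nn by simp
    qed
    then show "ennreal (K (x + t)) + (ennreal (K (y - t)) + Kr) + ennreal (lam / 2) * fidelity g ?\<Omega> (V P Q t) =
      (Kr + ennreal (lam / 2) * Fr) + ennreal (H P Q t)"
      unfolding F by (simp add: distrib_left ac_simps)
  qed
  have V_step: "V P Q t = step c (insert P (insert Q I)) (d(P := x + t, Q := y - t))"
    if PQ: "P \<notin> I" "Q \<notin> I" "P \<noteq> Q" for P Q t
    using I(1) PQ step_cong[of I d "d(P := x + t, Q := y - t)" c] by (force simp: V_def step_insert)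
  \<comment> \<open>A lower bound suffices for \<open>U\<close>: the total variation off the jump
    set is simply dropped, and the a.e. representation settles the fidelity term.\<close>
  have energy: "TV_Kg K lam g ?\<Omega> U \<ge> (Kr + ennreal (lam / 2) * Fr) + ennreal (H p q 0)"
  proof -
    have "d(p := x + 0, q := y - 0) = d" by (auto simp: x_def y_def)
    then have VJ: "V p q 0 = step c J d" using V_step[of p q 0] I(3-5) adj(3) by simp
    have "(\<Sum>z\<in>J. ennreal (K (d z))) = ennreal (K x) + (ennreal (K y) + Kr)"
      using I adj(3) by (simp add: Kr_def x_def y_def)
    moreover have "(\<Sum>\<^sub>\<infinity>z\<in>J. ennreal (K \<bar>Lim (ess_at_right z) U - Lim (ess_at_left z) U\<bar>)) = (\<Sum>z\<in>J. ennreal (K (d z)))"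
    proof -
      have "K \<bar>Lim (ess_at_right z) U - Lim (ess_at_left z) U\<bar> = K (d z)" if "z \<in> J" for z
        using d(1)[OF that] by (simp add: d(2)[OF that])
      then show ?thesis using J(2) by (simp cong: sum.cong)
    qed
    ultimately have "ennreal (K x) + (ennreal (K y) + Kr) \<le> TV_K K ?\<Omega> U"
      by (simp add: TV_K_def J(1))
    moreover have U_fid: "(\<integral>\<^sup>+z\<in>?\<Omega>. ennreal (\<bar>U z - g z\<bar>\<^sup>2) \<partial>lebesgue) = fidelity g ?\<Omega> (V p q 0)"
      unfolding fidelity_def VJ using U by (intro nn_integral_cong_AE) (auto elim!: eventually_mono split: split_indicator)
    moreover have "(Kr + ennreal (lam / 2) * Fr) + ennreal (H p q 0) =
        ennreal (K x) + (ennreal (K y) + Kr) + ennreal (lam / 2) * fidelity g ?\<Omega> (V p q 0)"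
      using V_fid[of p q 0, unfolded add_0_right diff_0_right, symmetric] order(2,3) adj(3) xy
      by (simp only: neg_less_0_iff_less)
    ultimately show ?thesis
      unfolding TV_Kg_def U_fid by (simp only: add_right_mono)
  qed
  have "H p q 0 \<le> H P Q t" if v: "\<alpha> < P" "P < Q" "Q < \<beta>" "- x < t" "t < y" for P Q t
  proof -
    let ?J = "insert P (insert Q I)" and ?d = "d(P := x + t, Q := y - t)"
    have PQ: "P \<notin> I" "Q \<notin> I" "P \<noteq> Q" using v I_sep by auto
    have Js: "finite ?J" "?J \<subseteq> ?\<Omega>" "\<And>z. z \<in> ?J \<Longrightarrow> 0 < ?d z"
      using I v order d(1) by auto
    have "V P Q t \<in> BV ?\<Omega>"
      unfolding V_step[OF PQ] by (rule step_BV[where d = ?d, OF Js(1,2) less_imp_le[OF Js(3)] ab])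
    then have "TV_Kg K lam g ?\<Omega> U \<le> TV_Kg K lam g ?\<Omega> (V P Q t)"
      using minimizer by (simp add: TV_Kg_minimizer_def)
    also have "\<dots> = (\<Sum>z\<in>?J. ennreal (K (?d z))) + ennreal (lam / 2) * fidelity g ?\<Omega> (V P Q t)"
    proof -
      have "TV_K K ?\<Omega> (V P Q t) = (\<Sum>z\<in>?J. ennreal (K (?d z)))"
        unfolding V_step[OF PQ] by (rule TV_K_step[OF Js(1,2) _ ab]) (rule Js(3))
      then show ?thesis unfolding TV_Kg_def fidelity_def by (rule arg_cong)
    qed
    also have "(\<Sum>z\<in>?J. ennreal (K (?d z))) = ennreal (K (x + t)) + (ennreal (K (y - t)) + Kr)"
    proof -
      have "(\<Sum>z\<in>I. ennreal (K (?d z))) = Kr" unfolding Kr_def using PQ by (intro sum.cong) auto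
      then show ?thesis using PQ I(1) by simp
    qed
    also note V_fid[OF v]
    finally have "(Kr + ennreal (lam / 2) * Fr) + ennreal (H p q 0) \<le> (Kr + ennreal (lam / 2) * Fr) + ennreal (H P Q t)"
      using energy by (rule order_trans[rotated])
    \<comment> \<open>Cancelling the common part in \<open>ennreal\<close> requires it to be finite;
      \<open>Fr\<close> integrates a bounded function over a bounded set.\<close>
    moreover have "Kr + ennreal (lam / 2) * Fr \<noteq> \<infinity>"
    proof -
      have "\<bar>V p q 0 z\<bar> \<le> \<bar>c\<bar> + (\<Sum>q\<in>I. \<bar>d q\<bar>) + x + y" for z
        using step_bounded[OF I(1), of c d z] xy by (auto simp: V_def indicator_def abs_if split: if_splits)
      then have "Fr < \<infinity>" unfolding Fr_def by (rule fidelity_finite[OF _ g]) auto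
      then show ?thesis using I(1) by (simp add: Kr_def ennreal_mult_eq_top_iff)
    qed
    ultimately have "ennreal (H p q 0) \<le> ennreal (H P Q t)"
      by (simp add: ennreal_add_left_cancel_le)
    then show ?thesis using H_nonneg[OF v] by simp
  qed
  then have "x = y \<and> q - p = x / k"
    unfolding H_def by (intro two_jump_stationary[OF k lam xy order(2) adj(3) order(3)])
  then show ?thesis by (simp add: x_def y_def)
qed

section \<open>Propagation of the pairwise comparison along all jumps\<close>

theorem theorem1p6:
  fixes a b lam k l :: real and g K U :: "real \<Rightarrow> real" and m :: nat and p :: "nat \<Rightarrow> real"
  assumes "a < b" and "lam > 0"
    and g: "k > 0" "\<And>x. x \<in> {a<..<b} \<Longrightarrow> g x = k * x + l"
    and K: "\<And>\<rho>. \<rho> \<ge> 0 \<Longrightarrow> K \<rho> = \<rho> / (1 + \<rho>)"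
    and minimizer: "TV_Kg_minimizer K lam g {a<..<b} U"
    and mono: "mono_on {a<..<b} U"
    and pc: "piecewise_constant_on {a<..<b} U"
    and points: "strict_mono_on {1..m} p" "\<And>i. i \<in> {1..m} \<Longrightarrow> a < p i \<and> p i < b"
    and jumps: "jump_set {a<..<b} U = p ` {1..m}"
  shows "(\<forall>i\<in>{1..<m}. \<forall>j\<in>{1..<m}. p (i + 1) - p i = p (j + 1) - p j) \<and>
    (\<forall>i\<in>{1..m}. \<forall>j\<in>{1..m}.
       Lim (at_right (p i)) U - Lim (at_left (p i)) U = Lim (at_right (p j)) U - Lim (at_left (p j)) U)"
proof -
  define J where "J = p ` {1..m}"
  have J: "jump_set {a<..<b} U = J" "finite J" using jumps by (simp_all add: J_def)
  obtain c d where U: "AE x in lebesgue. x \<in> {a<..<b} \<longrightarrow> U x = step c J d x"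
    and d: "\<And>q. q \<in> J \<Longrightarrow> 0 < d q"
    and Lim: "\<And>q. q \<in> J \<Longrightarrow> Lim (at_right q) U - Lim (at_left q) U = d q"
    and ess_Lim: "\<And>q. q \<in> J \<Longrightarrow> Lim (ess_at_right q) U - Lim (ess_at_left q) U = d q"
    using piecewise_constant_eq_step[OF pc mono, unfolded J(1), OF J(2)] by blast
  have adjacent: "d (p i) = d (p (i + 1)) \<and> p (i + 1) - p i = d (p i) / k" if i: "i \<in> {1..<m}" for i
  proof (rule adjacent_jumps[OF assms(1,2) g K minimizer J U d ess_Lim])
    show "p i \<in> J" "p (i + 1) \<in> J" using i by (auto simp: J_def)
    have less_iff: "p j < p j' \<longleftrightarrow> j < j'" if "j \<in> {1..m}" "j' \<in> {1..m}" for j j'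
      using strict_mono_on_less[OF points(1) that] .
    show "p i < p (i + 1)" using less_iff[of i "i + 1"] i by simp
    show "J \<inter> {p i<..<p (i + 1)} = {}"
      using less_iff[of i] less_iff[of _ "i + 1"] i by (force simp: J_def)
  qed
  \<comment> \<open>Indices start at 1: the case 0 of the induction is vacuous, and
    \<open>Suc 0\<close> is the actual base, treated by the split on \<open>i = 0\<close>.\<close>
  have const: "d (p i) = d (p 1)" if "i \<in> {1..m}" for i
    using that
  proof (induction i)
    case (Suc i)
    then show ?case using adjacent[of i] by (cases "i = 0") auto
  qed simp
  have "p (i + 1) - p i = d (p 1) / k" if "i \<in> {1..<m}" for i
    using adjacent[OF that] const[of i] that by simp
  moreover have "Lim (at_right (p i)) U - Lim (at_left (p i)) U = d (p 1)" if "i \<in> {1..m}" for i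
    using Lim[of "p i"] const[OF that] that by (simp add: J_def)
  ultimately show ?thesis by simp
qed

end
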